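(* Let $U_{AB}$ be a unitary and $F$ a concave, monotone increasing function. Suppose that, for every $\epsilon$, any $\epsilon$-correct (in diamond norm) implementation of $U_{AB}$ as a non-local quantum computation using a pure resource state $|\Psi\rangle_{LR}$ must have $S(R)_\Psi\ge\lambda-F(\epsilon)$. Then any $\epsilon$-correct implementation of $U_{AB}$ as a non-local quantum computation using a (possibly mixed) resource state $\Psi_{LR}$ must satisfy \[ E_f(L:R)_\Psi\ \ge\ \lambda-F\big(d_{AB}\sqrt{2\epsilon}\big). \]
   Context: A non-local quantum computation (NLQC) implementing a channel on $AB$ is a channel of the form $(\mathcal{W}_{K_aM_a\to A}\otimes\mathcal{W}'_{K_bM_b\to B})\circ(\mathcal{V}_{AL\to K_aM_b}\otimes\mathcal{V}'_{RB\to M_aK_b})(\cdot\otimes\Psi_{LR})$ with a shared resource state $\Psi_{LR}$ ($L$ Alice, $R$ Bob); it is an $\epsilon$-correct implementation of $U$ if its diamond norm distance (defined with $\|X\|_1=\mathrm{tr}|X|$) to $\rho\mapsto U\rho U^\dagger$ is at most $\epsilon$. $d_{AB}=\dim(\mathcal{H}_A\otimes\mathcal{H}_B)$, $S$ is the von Neumann entropy, and $E_f(L:R)_\rho=\min\sum_ip_iS(R)_{\psi_i}$ over ensembles $\{p_i,|\psi_i\rangle\}$ with $\rho=\sum_ip_i|\psi_i\rangle\langle\psi_i|$. *)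

theory Defs
  imports "HOL-Analysis.Convex" "Jordan_Normal_Form.Schur_Decomposition"
begin

text \<open>Finite-dimensional quantum systems are modelled by their dimensions (natural numbers);
operators are complex matrices (Jordan_Normal_Form).  Composite systems use the Kronecker
product with the convention
(A \<otimes> B)((i1*dB+i2),(j1*dB+j2)) = A(i1,j1) B(i2,j2).\<close>

definition kron :: "complex mat \<Rightarrow> complex mat \<Rightarrow> complex mat" where
  "kron A B = mat (dim_row A * dim_row B) (dim_col A * dim_col B)
     (\<lambda>(i,j). A $$ (i div dim_row B, j div dim_col B) * B $$ (i mod dim_row B, j mod dim_col B))"

definition mtrace :: "complex mat \<Rightarrow> complex" where
  "mtrace A = (\<Sum>i<dim_row A. A $$ (i,i))"

definition msum :: "nat \<Rightarrow> complex mat list \<Rightarrow> complex mat" where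
  "msum n Ms = foldr (+) Ms (0\<^sub>m n n)"

definition adj :: "complex mat \<Rightarrow> complex mat" where
  "adj A = mat_adjoint A"

definition unitary_mat :: "nat \<Rightarrow> complex mat \<Rightarrow> bool" where
  "unitary_mat n U \<longleftrightarrow> U \<in> carrier_mat n n \<and> U * adj U = 1\<^sub>m n \<and> adj U * U = 1\<^sub>m n"

definition psd :: "nat \<Rightarrow> complex mat \<Rightarrow> bool" where
  "psd n M \<longleftrightarrow> M \<in> carrier_mat n n \<and> adj M = M \<and>
     (\<forall>v \<in> carrier_vec n. 0 \<le> Re (conjugate v \<bullet> (M *\<^sub>v v)))"

definition density :: "nat \<Rightarrow> complex mat \<Rightarrow> bool" where
  "density n \<rho> \<longleftrightarrow> psd n \<rho> \<and> mtrace \<rho> = 1"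

definition is_unit_vec :: "nat \<Rightarrow> complex vec \<Rightarrow> bool" where
  "is_unit_vec n v \<longleftrightarrow> v \<in> carrier_vec n \<and> conjugate v \<bullet> v = 1"

definition proj :: "complex vec \<Rightarrow> complex mat" where
  "proj v = mat (dim_vec v) (dim_vec v) (\<lambda>(i,j). v $ i * cnj (v $ j))"

definition trace_norm :: "complex mat \<Rightarrow> real" where
  "trace_norm X = Re (mtrace (THE S. psd (dim_col X) S \<and> S * S = adj X * X))"

definition ptrace1 :: "nat \<Rightarrow> nat \<Rightarrow> complex mat \<Rightarrow> complex mat" where
  "ptrace1 d1 d2 M = mat d2 d2 (\<lambda>(i,j). \<Sum>k<d1. M $$ (k*d2 + i, k*d2 + j))"

definition vn_entropy :: "nat \<Rightarrow> complex mat \<Rightarrow> real" where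
  "vn_entropy n \<rho> = (THE s. \<exists>U lam. unitary_mat n U \<and>
      \<rho> = U * mat n n (\<lambda>(i,j). if i = j then complex_of_real (lam i) else 0) * adj U \<and>
      s = - (\<Sum>i<n. if lam i = 0 then 0 else lam i * log 2 (lam i)))"

definition ent_formation :: "nat \<Rightarrow> nat \<Rightarrow> complex mat \<Rightarrow> real" where
  "ent_formation dL dR \<rho> = Inf {(\<Sum>(p,\<psi>)\<leftarrow>ens. p * vn_entropy dR (ptrace1 dL dR (proj \<psi>))) | ens.
      (\<forall>(p,\<psi>)\<in>set ens. 0 \<le> p \<and> is_unit_vec (dL*dR) \<psi>) \<and>
      (\<Sum>(p,\<psi>)\<leftarrow>ens. p) = 1 \<and>
      \<rho> = msum (dL*dR) (map (\<lambda>(p,\<psi>). complex_of_real p \<cdot>\<^sub>m proj \<psi>) ens)}"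

definition kraus_channel :: "nat \<Rightarrow> nat \<Rightarrow> complex mat list \<Rightarrow> bool" where
  "kraus_channel din dout Ks \<longleftrightarrow> (\<forall>K\<in>set Ks. K \<in> carrier_mat dout din) \<and>
     msum din (map (\<lambda>K. adj K * K) Ks) = 1\<^sub>m din"

definition apply_kraus :: "nat \<Rightarrow> complex mat list \<Rightarrow> complex mat \<Rightarrow> complex mat" where
  "apply_kraus dout Ks X = msum dout (map (\<lambda>K. K * X * adj K) Ks)"

definition kraus_tensor :: "complex mat list \<Rightarrow> complex mat list \<Rightarrow> complex mat list" where
  "kraus_tensor Ks Ls = [kron K L. K \<leftarrow> Ks, L \<leftarrow> Ls]"

definition swap_mat :: "nat \<Rightarrow> nat \<Rightarrow> complex mat" where
  "swap_mat m n = mat (n*m) (m*n)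
     (\<lambda>(i,j). if i div m = j mod n \<and> i mod m = j div n then 1 else 0)"

text \<open>The NLQC channel on AB:
 (W_{KaMa\<rightarrow>A} \<otimes> W'_{KbMb\<rightarrow>B}) \<circ> (V_{AL\<rightarrow>KaMb} \<otimes> V'_{RB\<rightarrow>MaKb}) (\<rho> \<otimes> \<Psi>_{LR}).
 The subsystems are reordered A B L R \<rightarrow> A L R B before the first round and
 Ka Mb Ma Kb \<rightarrow> Ka Ma Kb Mb (swap Mb past Ma Kb) before the second round.\<close>
definition nlqc :: "nat \<Rightarrow> nat \<Rightarrow> nat \<Rightarrow> nat \<Rightarrow> nat \<Rightarrow> nat \<Rightarrow> nat \<Rightarrow> nat \<Rightarrow>
    complex mat list \<Rightarrow> complex mat list \<Rightarrow> complex mat list \<Rightarrow> complex mat list \<Rightarrow>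
    complex mat \<Rightarrow> complex mat \<Rightarrow> complex mat" where
  "nlqc dA dB dL dR dKa dMa dKb dMb V V' W W' \<Psi> \<rho> =
     (let P1 = kron (1\<^sub>m dA) (swap_mat dB (dL*dR));
          X1 = P1 * kron \<rho> \<Psi> * adj P1;
          X2 = apply_kraus (dKa*dMb*(dMa*dKb)) (kraus_tensor V V') X1;
          P2 = kron (1\<^sub>m dKa) (swap_mat dMb (dMa*dKb));
          X3 = P2 * X2 * adj P2
      in apply_kraus (dA*dB) (kraus_tensor W W') X3)"

text \<open>(\<Phi> \<otimes> id_r)(X) for a map \<Phi> from n\<times>n to m\<times>m matrices, with X on H_n \<otimes> H_r.\<close>
definition ext_id :: "(complex mat \<Rightarrow> complex mat) \<Rightarrow> nat \<Rightarrow> nat \<Rightarrow> nat \<Rightarrow> complex mat \<Rightarrow> complex mat" where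
  "ext_id \<Phi> n m r X = mat (m*r) (m*r) (\<lambda>(p,q).
      \<Phi> (mat n n (\<lambda>(i,j). X $$ (i*r + p mod r, j*r + q mod r))) $$ (p div r, q div r))"

definition diamond_norm :: "(complex mat \<Rightarrow> complex mat) \<Rightarrow> nat \<Rightarrow> nat \<Rightarrow> real" where
  "diamond_norm \<Phi> n m = Sup {trace_norm (ext_id \<Phi> n m n X) | X.
      X \<in> carrier_mat (n*n) (n*n) \<and> trace_norm X \<le> 1}"

definition nlqc_correct :: "nat \<Rightarrow> nat \<Rightarrow> complex mat \<Rightarrow> real \<Rightarrow> nat \<Rightarrow> nat \<Rightarrow> nat \<Rightarrow> nat \<Rightarrow> nat \<Rightarrow> nat \<Rightarrow>
    complex mat list \<Rightarrow> complex mat list \<Rightarrow> complex mat list \<Rightarrow> complex mat list \<Rightarrow> complex mat \<Rightarrow> bool" where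
  "nlqc_correct dA dB U \<epsilon> dL dR dKa dMa dKb dMb V V' W W' \<Psi> \<longleftrightarrow>
     kraus_channel (dA*dL) (dKa*dMb) V \<and> kraus_channel (dR*dB) (dMa*dKb) V' \<and>
     kraus_channel (dKa*dMa) dA W \<and> kraus_channel (dKb*dMb) dB W' \<and>
     density (dL*dR) \<Psi> \<and>
     diamond_norm (\<lambda>\<rho>. nlqc dA dB dL dR dKa dMa dKb dMb V V' W W' \<Psi> \<rho> - U * \<rho> * adj U)
        (dA*dB) (dA*dB) \<le> \<epsilon>"

end

theory Submission
  imports Defs "HOL-Analysis.L2_Norm"
begin

text \<open>
  Fix an ensemble \<open>{p\<^sub>i, \<psi>\<^sub>i}\<close> for \<open>\<Psi>\<close> and let \<open>f\<^sub>i\<close> be the entanglement fidelity with \<open>U\<close> of the channel \<open>N\<^sub>i\<close>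
  obtained from the resource \<open>\<psi>\<^sub>i\<close>. Fidelity is affine in the resource, so the channel built from \<open>\<Psi>\<close> has
  fidelity \<open>f = \<Sum>\<^sub>i p\<^sub>i f\<^sub>i\<close>, and testing on the maximally entangled state gives \<open>1 - f \<le> \<epsilon>/2\<close>. Conversely
  the diamond distance \<open>\<epsilon>\<^sub>i\<close> of \<open>N\<^sub>i\<close> from \<open>U\<close> is at most \<open>2 d \<surd>(1 - f\<^sub>i)\<close>, so by Cauchy-Schwarz
  \<open>\<Sum>\<^sub>i p\<^sub>i \<epsilon>\<^sub>i \<le> 2 d \<surd>(1 - f) \<le> d \<surd>(2 \<epsilon>)\<close>; the bound for pure resources together with concavity and
  monotonicity of \<open>F\<close> concludes.

  The trace norm enters only as the minimum of \<open>\<Sum>\<^sub>j \<parallel>x\<^sub>j\<parallel> \<parallel>y\<^sub>j\<parallel>\<close> over decompositions \<open>X = \<Sum>\<^sub>j x\<^sub>j y\<^sub>j\<^sup>*\<close>. Hence the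
  diamond norm of \<open>X \<mapsto> \<Sum>\<^sub>j A\<^sub>j X B\<^sub>j\<^sup>*\<close> is at most the sum of the products of Frobenius norms
  \<open>\<parallel>A\<^sub>j\<parallel> \<parallel>B\<^sub>j\<parallel>\<close>, and the upper bound on \<open>\<epsilon>\<^sub>i\<close> follows from a suitable choice of \<open>A\<^sub>j\<close>, \<open>B\<^sub>j\<close>.
\<close>

section \<open>Hermitian matrices and their orthonormal eigenbases\<close>

text \<open>Vectors are total functions of which only the values at indices below \<open>n\<close>
  count, so the linearity rules hold without carrier conditions and \<open>ip_cong\<close> takes the
  place of equality of vectors. The first argument is the conjugate-linear one.\<close>

definition ip :: "nat \<Rightarrow> (nat \<Rightarrow> complex) \<Rightarrow> (nat \<Rightarrow> complex) \<Rightarrow> complex" where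
  "ip n x y = (\<Sum>p<n. cnj (x p) * y p)"

definition nrm :: "nat \<Rightarrow> (nat \<Rightarrow> complex) \<Rightarrow> real" where
  "nrm n x = L2_set (\<lambda>p. cmod (x p)) {..<n}"

lemma nrm_nonneg [simp]: "0 \<le> nrm n x"
  by (simp add: nrm_def)

lemma nrm_sq: "(nrm n x)\<^sup>2 = (\<Sum>p<n. (cmod (x p))\<^sup>2)"
  by (simp add: nrm_def L2_set_def sum_nonneg)

lemma ip_self: "ip n x x = complex_of_real ((nrm n x)\<^sup>2)"
  unfolding ip_def nrm_sq of_real_sum complex_norm_square by (simp add: mult.commute)

lemma cnj_ip: "cnj (ip n x y) = ip n y x"
  by (simp add: ip_def mult.commute)

lemma cmod_ip_le: "cmod (ip n x y) \<le> nrm n x * nrm n y"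
proof -
  have "cmod (ip n x y) \<le> (\<Sum>p<n. \<bar>cmod (x p)\<bar> * \<bar>cmod (y p)\<bar>)"
    unfolding ip_def by (rule order_trans[OF norm_sum]) (simp add: norm_mult)
  also have "\<dots> \<le> nrm n x * nrm n y"
    unfolding nrm_def by (rule L2_set_mult_ineq)
  finally show ?thesis .
qed

lemma ip_sum_right: "ip n x (\<lambda>p. \<Sum>k\<in>K. f k p) = (\<Sum>k\<in>K. ip n x (f k))"
  unfolding ip_def sum_distrib_left by (rule sum.swap)

lemma ip_sum_left: "ip n (\<lambda>p. \<Sum>k\<in>K. f k p) y = (\<Sum>k\<in>K. ip n (f k) y)"
  unfolding ip_def cnj_sum sum_distrib_right by (rule sum.swap)

lemma ip_scale_right: "ip n x (\<lambda>p. c * y p) = c * ip n x y"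
  by (simp add: ip_def sum_distrib_left mult_ac)

lemma ip_scale_left: "ip n (\<lambda>p. c * x p) y = cnj c * ip n x y"
  by (simp add: ip_def sum_distrib_left mult_ac)

lemma ip_diff_right: "ip n x (\<lambda>p. y p - z p) = ip n x y - ip n x z"
  by (simp add: ip_def algebra_simps sum_subtractf)

lemma ip_diff_left: "ip n (\<lambda>p. x p - z p) y = ip n x y - ip n z y"
  by (simp add: ip_def algebra_simps sum_subtractf)

lemma ip_cong: "(\<And>p. p < n \<Longrightarrow> x p = x' p) \<Longrightarrow> (\<And>p. p < n \<Longrightarrow> y p = y' p) \<Longrightarrow> ip n x y = ip n x' y'"
  unfolding ip_def by auto

lemma nrm_eq_0: "nrm n x = 0 \<Longrightarrow> p < n \<Longrightarrow> x p = 0"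
  unfolding nrm_def by (simp add: L2_set_eq_0_iff)

text \<open>Removing from \<open>x\<close> its components along the \<open>g k\<close> leaves a
  residual \<open>z\<close> orthogonal to their sum \<open>s\<close>; its squared norm is the
  difference of the two sides.\<close>

lemma bessel:
  assumes "finite K"
    and orth: "\<And>j k. j \<in> K \<Longrightarrow> k \<in> K \<Longrightarrow> ip n (g j) (g k) = (if j = k then 1 else 0)"
  shows "(\<Sum>k\<in>K. (cmod (ip n (g k) x))\<^sup>2) \<le> (nrm n x)\<^sup>2"
proof -
  define c where "c k = ip n (g k) x" for k
  define s where "s p = (\<Sum>k\<in>K. c k * g k p)" for p
  define z where "z p = x p - s p" for p
  have gs: "ip n (g j) s = c j" if "j \<in> K" for j
  proof -
    have "ip n (g j) s = (\<Sum>k\<in>K. c k * ip n (g j) (g k))"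
      unfolding s_def by (simp add: ip_sum_right ip_scale_right)
    also have "\<dots> = (\<Sum>k\<in>K. if j = k then c k else 0)"
      using that by (intro sum.cong) (auto simp: orth)
    finally show ?thesis using that \<open>finite K\<close> by simp
  qed
  have zs: "ip n s z = 0"
  proof -
    have "ip n s z = (\<Sum>k\<in>K. cnj (c k) * ip n (g k) z)"
      unfolding s_def by (simp add: ip_sum_left ip_scale_left)
    also have "\<dots> = 0"
      by (intro sum.neutral) (simp add: z_def[abs_def] ip_diff_right gs, simp add: c_def)
    finally show ?thesis .
  qed
  have "ip n z z = ip n x z - ip n s z"
    by (subst z_def[abs_def]) (simp add: ip_diff_left)
  also have "\<dots> = ip n x x - ip n x s"
    unfolding zs by (simp add: z_def[abs_def] ip_diff_right)
  also have "ip n x s = (\<Sum>k\<in>K. c k * cnj (c k))"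
    unfolding s_def ip_sum_right ip_scale_right by (simp add: c_def cnj_ip)
  also have "\<dots> = complex_of_real (\<Sum>k\<in>K. (cmod (c k))\<^sup>2)"
    unfolding of_real_sum complex_norm_square by simp
  finally have "(nrm n z)\<^sup>2 = (nrm n x)\<^sup>2 - (\<Sum>k\<in>K. (cmod (c k))\<^sup>2)"
    unfolding ip_self by (metis of_real_diff of_real_eq_iff)
  then show ?thesis
    using zero_le_power2[of "nrm n z"] by (simp add: c_def)
qed

section \<open>Adjoints, traces and the existence of eigenvectors\<close>

lemma adj_carrier: "A \<in> carrier_mat m n \<Longrightarrow> adj A \<in> carrier_mat n m"
  unfolding adj_def mat_adjoint_def by auto

lemma dim_adj [simp]: "dim_row (adj A) = dim_col A" "dim_col (adj A) = dim_row A"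
  unfolding adj_def mat_adjoint_def by auto

lemma index_adj [simp]: "i < dim_col A \<Longrightarrow> j < dim_row A \<Longrightarrow> adj A $$ (i,j) = cnj (A $$ (j,i))"
  unfolding adj_def mat_adjoint_def by (simp add: mat_of_rows_index)

lemma index_mult_sum:
  assumes "A \<in> carrier_mat m n" "B \<in> carrier_mat n k" "i < m" "j < k"
  shows "(A * B) $$ (i,j) = (\<Sum>l<n. A $$ (i,l) * B $$ (l,j))"
  using assms by (simp add: scalar_prod_def lessThan_atLeast0)

lemma mtrace_mult_commute:
  assumes "A \<in> carrier_mat m n" "B \<in> carrier_mat n m"
  shows "mtrace (A * B) = mtrace (B * A)"
proof -
  have "mtrace (A * B) = (\<Sum>i<m. \<Sum>l<n. A $$ (i,l) * B $$ (l,i))"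
    using assms by (simp add: mtrace_def scalar_prod_def lessThan_atLeast0)
  also have "\<dots> = (\<Sum>l<n. \<Sum>i<m. A $$ (i,l) * B $$ (l,i))"
    by (rule sum.swap)
  also have "\<dots> = mtrace (B * A)"
    using assms by (simp add: mtrace_def scalar_prod_def lessThan_atLeast0 mult.commute)
  finally show ?thesis .
qed

text \<open>If \<open>c\<close> were the only eigenvalue, every diagonal entry of a Schur triangular
  form would be \<open>c\<close>; similarity preserves the trace, which would then be
  \<open>n * c\<close>.\<close>

lemma exists_eigenvector_avoiding:
  assumes A: "A \<in> carrier_mat n n" and tr: "mtrace A \<noteq> of_nat n * c"
  shows "\<exists>v \<mu>. eigenvector A v \<mu> \<and> \<mu> \<noteq> c"
proof (rule ccontr)
  assume no: "\<not> ?thesis"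
  obtain as where as: "char_poly A = (\<Prod>a\<leftarrow>as. [:- a, 1:])" "length as = n"
    using char_poly_factorized[OF A] by blast
  have "a = c" if "a \<in> set as" for a
  proof -
    have "poly (char_poly A) a = 0"
      using that unfolding as(1) poly_prod_list prod_list_zero_iff by (auto simp: image_iff)
    then have "eigenvalue A a"
      using eigenvalue_root_char_poly[OF A] by simp
    then show ?thesis using no unfolding eigenvalue_def by auto
  qed
  then have asc: "as ! i = c" if "i < n" for i using that as(2) by auto
  obtain B P Q where BPQ: "schur_decomposition A as = (B,P,Q)"
    by (cases "schur_decomposition A as") auto
  from schur_decomposition[OF A as(1) BPQ]
  have sim: "similar_mat_wit A B P Q" and diag: "diag_mat B = as" by auto
  note w = similar_mat_witD2[OF A sim]
  have "B $$ (i,i) = c" if "i < n" for i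
    using asc[OF that] w(5) that unfolding diag[symmetric] by (simp add: diag_mat_def)
  then have "mtrace B = of_nat n * c"
    using w(5) by (simp add: mtrace_def)
  moreover have "mtrace A = mtrace B"
  proof -
    have "mtrace A = mtrace (P * (B * Q))"
      using w(3,5,6,7) by (simp add: assoc_mult_mat[of _ n n _ n _ n])
    also have "\<dots> = mtrace (B * Q * P)"
      by (rule mtrace_mult_commute[of _ n n]) (use w in auto)
    also have "B * Q * P = B"
      using w by (simp add: assoc_mult_mat[of _ n n _ n _ n])
    finally show ?thesis .
  qed
  ultimately show False using tr by simp
qed

section \<open>Spectral theorem for Hermitian matrices\<close>

definition herm_fun :: "nat \<Rightarrow> (nat \<Rightarrow> nat \<Rightarrow> complex) \<Rightarrow> bool" where
  "herm_fun n A \<longleftrightarrow> (\<forall>p<n. \<forall>q<n. A p q = cnj (A q p))"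

lemma herm_funD: "herm_fun n A \<Longrightarrow> p < n \<Longrightarrow> q < n \<Longrightarrow> cnj (A p q) = A q p"
  unfolding herm_fun_def by (metis complex_cnj_cnj)

definition mv :: "nat \<Rightarrow> (nat \<Rightarrow> nat \<Rightarrow> complex) \<Rightarrow> (nat \<Rightarrow> complex) \<Rightarrow> nat \<Rightarrow> complex" where
  "mv n A x p = (\<Sum>q<n. A p q * x q)"

lemma ip_mv_left: "ip n (mv n A x) y = ip n x (mv n (\<lambda>p q. cnj (A q p)) y)"
proof -
  have "ip n (mv n A x) y = (\<Sum>p<n. \<Sum>q<n. cnj (A p q) * cnj (x q) * y p)"
    by (simp add: ip_def mv_def sum_distrib_right)
  also have "\<dots> = (\<Sum>q<n. \<Sum>p<n. cnj (A p q) * cnj (x q) * y p)"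
    by (rule sum.swap)
  also have "\<dots> = ip n x (mv n (\<lambda>p q. cnj (A q p)) y)"
    by (simp add: ip_def mv_def sum_distrib_left mult_ac)
  finally show ?thesis .
qed

lemma ip_mv_herm:
  assumes "herm_fun n A"
  shows "ip n (mv n A x) y = ip n x (mv n A y)"
  unfolding ip_mv_left by (rule ip_cong) (simp_all add: mv_def herm_funD[OF assms])

lemma orthonormal_eigen_step:
  assumes h: "herm_fun n A" and "k < n"
    and orth: "\<And>i j. i < k \<Longrightarrow> j < k \<Longrightarrow> ip n (e i) (e j) = (if i = j then 1 else 0)"
    and eig: "\<And>j p. j < k \<Longrightarrow> p < n \<Longrightarrow> mv n A (e j) p = complex_of_real (l j) * e j p"
  shows "\<exists>v m. ip n v v = 1 \<and> (\<forall>j<k. ip n (e j) v = 0) \<and>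
           (\<forall>p<n. mv n A v p = complex_of_real m * v p)"
proof -
  \<comment> \<open>Moving the known eigenvalues to \<^term>\<open>c\<close> leaves a Hermitian matrix whose trace is not \<^term>\<open>n * c\<close>; an
    eigenvector for an eigenvalue other than \<^term>\<open>c\<close> is then orthogonal to the known ones.\<close>
  define t where "t = (\<Sum>p<n. A p p) - (\<Sum>j<k. complex_of_real (l j))"
  \<comment> \<open>The trace of \<open>B\<close> will be \<open>t + k * c\<close>, and its equality
    with \<open>n * c\<close> would force \<open>Re t = (n - k) * c\<close>; the summand
    \<open>1\<close> moves \<open>c\<close> off that value.\<close>
  define c :: real where "c = Re t / (real n - real k) + 1"
  define B where "B p q = A p q - (\<Sum>j<k. complex_of_real (l j - c) * e j p * cnj (e j q))" for p q
  have hB: "herm_fun n B"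
    unfolding herm_fun_def
  proof (intro allI impI)
    fix p q assume "p < n" "q < n"
    then show "B p q = cnj (B q p)"
      by (simp add: B_def herm_funD[OF h] mult_ac)
  qed
  have mvB: "mv n B x p = mv n A x p - (\<Sum>j<k. complex_of_real (l j - c) * ip n (e j) x * e j p)" for x p
  proof -
    have "mv n B x p = mv n A x p - (\<Sum>q<n. \<Sum>j<k. complex_of_real (l j - c) * e j p * cnj (e j q) * x q)"
      by (simp add: mv_def B_def left_diff_distrib sum_subtractf sum_distrib_right)
    also have "(\<Sum>q<n. \<Sum>j<k. complex_of_real (l j - c) * e j p * cnj (e j q) * x q)
       = (\<Sum>j<k. \<Sum>q<n. complex_of_real (l j - c) * e j p * cnj (e j q) * x q)"
      by (rule sum.swap)
    also have "\<dots> = (\<Sum>j<k. complex_of_real (l j - c) * ip n (e j) x * e j p)"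
      by (simp add: ip_def sum_distrib_left sum_distrib_right mult_ac)
    finally show ?thesis .
  qed
  have Be: "mv n B (e j) p = complex_of_real c * e j p" if "j < k" "p < n" for j p
  proof -
    have "(\<Sum>i<k. complex_of_real (l i - c) * ip n (e i) (e j) * e i p) =
        (\<Sum>i<k. if i = j then complex_of_real (l j - c) * e j p else 0)"
      using that by (intro sum.cong) (auto simp: orth)
    then show ?thesis using that by (simp add: mvB eig algebra_simps)
  qed
  have trB: "(\<Sum>p<n. B p p) = t + of_nat k * complex_of_real c"
  proof -
    have "(\<Sum>p<n. \<Sum>j<k. complex_of_real (l j - c) * e j p * cnj (e j p))
       = (\<Sum>j<k. \<Sum>p<n. complex_of_real (l j - c) * e j p * cnj (e j p))"
      by (rule sum.swap)
    also have "\<dots> = (\<Sum>j<k. complex_of_real (l j - c) * ip n (e j) (e j))"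
      by (simp add: ip_def sum_distrib_left mult_ac)
    also have "\<dots> = (\<Sum>j<k. complex_of_real (l j)) - of_nat k * complex_of_real c"
      by (simp add: orth sum_subtractf)
    finally show ?thesis by (simp add: B_def t_def sum_subtractf)
  qed
  define M where "M = mat n n (\<lambda>(p,q). B p q)"
  have M: "M \<in> carrier_mat n n" by (simp add: M_def)
  have "mtrace M \<noteq> of_nat n * complex_of_real c"
  proof
    assume "mtrace M = of_nat n * complex_of_real c"
    then have "t + of_nat k * complex_of_real c = of_nat n * complex_of_real c"
      by (simp add: mtrace_def M_def trB)
    from arg_cong[OF this, of Re] have "Re t = (real n - real k) * c" by (simp add: algebra_simps)
    moreover have "(real n - real k) * c = Re t + (real n - real k)"
      using \<open>k < n\<close> by (simp add: c_def field_simps)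
    ultimately show False using \<open>k < n\<close> by simp
  qed
  from exists_eigenvector_avoiding[OF M this] obtain w \<mu> where
    w: "eigenvector M w \<mu>" "\<mu> \<noteq> complex_of_real c" by blast
  have wc: "w \<in> carrier_vec n" and w0: "w \<noteq> 0\<^sub>v n" and ww: "M *\<^sub>v w = \<mu> \<cdot>\<^sub>v w"
    using w(1) M unfolding eigenvector_def by auto
  have Bw: "mv n B (($) w) p = \<mu> * w $ p" if "p < n" for p
    using arg_cong[OF ww, of "\<lambda>u. u $ p"] that wc
    by (simp add: M_def mv_def scalar_prod_def lessThan_atLeast0)
  have ortho: "ip n (e j) (($) w) = 0" if "j < k" for j
  proof -
    have "complex_of_real c * ip n (e j) (($) w) = ip n (mv n B (e j)) (($) w)"
      by (subst ip_cong[OF Be[OF that] refl]) (simp_all add: ip_scale_left)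
    also have "\<dots> = ip n (e j) (mv n B (($) w))" by (rule ip_mv_herm[OF hB])
    also have "\<dots> = \<mu> * ip n (e j) (($) w)"
      by (subst ip_cong[OF refl Bw]) (simp_all add: ip_scale_right)
    finally show ?thesis using w(2) by simp
  qed
  have Aw: "mv n A (($) w) p = \<mu> * w $ p" if "p < n" for p
    using Bw[OF that] by (simp add: mvB ortho)
  have nz: "nrm n (($) w) \<noteq> 0"
  proof
    assume "nrm n (($) w) = 0"
    then have "w = 0\<^sub>v n" using nrm_eq_0 wc by (intro eq_vecI) auto
    then show False using w0 by simp
  qed
  have "\<mu> * ip n (($) w) (($) w) = ip n (($) w) (mv n A (($) w))"
    by (subst ip_cong[OF refl Aw]) (simp_all add: ip_scale_right)
  also have "\<dots> = ip n (mv n A (($) w)) (($) w)" by (rule ip_mv_herm[OF h, symmetric])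
  also have "\<dots> = cnj \<mu> * ip n (($) w) (($) w)"
    by (subst ip_cong[OF Aw refl]) (simp_all add: ip_scale_left)
  finally have "\<mu> = cnj \<mu>" using nz by (simp add: ip_self)
  then have \<mu>: "\<mu> = complex_of_real (Re \<mu>)"
    by (metis Reals_cnj_iff of_real_Re)
  define v where "v p = complex_of_real (1 / nrm n (($) w)) * w $ p" for p
  have "ip n v v = 1"
    unfolding v_def ip_scale_left ip_scale_right using nz by (simp add: ip_self power2_eq_square)
  moreover have "\<forall>j<k. ip n (e j) v = 0"
    unfolding v_def ip_scale_right using ortho by simp
  moreover have "mv n A v p = complex_of_real (Re \<mu>) * v p" if "p < n" for p
  proof -
    have "mv n A v p = complex_of_real (1 / nrm n (($) w)) * mv n A (($) w) p"
      by (simp add: mv_def v_def sum_distrib_left mult_ac)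
    then show ?thesis using Aw[OF that] \<mu> by (simp add: v_def mult_ac)
  qed
  ultimately show ?thesis by blast
qed

text \<open>Partial families of every size \<open>k \<le> n\<close> are allowed so that eigenvectors
  can be added one at a time; \<open>k = n\<close> is the spectral theorem.\<close>

lemma orthonormal_eigenvectors:
  assumes h: "herm_fun n A" and "k \<le> n"
  shows "\<exists>e l. (\<forall>i<k. \<forall>j<k. ip n (e i) (e j) = (if i = j then 1 else 0)) \<and>
     (\<forall>j<k. \<forall>p<n. mv n A (e j) p = complex_of_real (l j) * e j p)"
  using \<open>k \<le> n\<close>
proof (induction k)
  case (Suc k)
  then obtain e l where
    o: "\<forall>i<k. \<forall>j<k. ip n (e i) (e j) = (if i = j then 1 else 0)" and
    v: "\<forall>j<k. \<forall>p<n. mv n A (e j) p = complex_of_real (l j) * e j p"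
    using Suc_leD by blast
  obtain w m where w: "ip n w w = 1" "\<forall>j<k. ip n (e j) w = 0"
     "\<forall>p<n. mv n A w p = complex_of_real m * w p"
    using orthonormal_eigen_step[OF h, of k e l] Suc.prems o v by (auto simp: Suc_le_eq)
  have w': "ip n w (e j) = 0" if "j < k" for j
    using w(2) that cnj_ip[of n "e j" w] by simp
  show ?case
    by (rule exI[of _ "e(k := w)"], rule exI[of _ "l(k := m)"])
       (use w w' o v in \<open>auto simp: less_Suc_eq\<close>)
qed auto

text \<open>Orthonormality says that the adjoint of the square matrix with columns
  \<open>e k\<close> is its left inverse; a left inverse of a square matrix is also a right inverse,
  which is completeness.\<close>

lemma orthonormal_complete:
  assumes o: "\<And>i j. i < n \<Longrightarrow> j < n \<Longrightarrow> ip n (e i) (e j) = (if i = j then 1 else 0)"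
    and "p < n" "q < n"
  shows "(\<Sum>k<n. e k p * cnj (e k q)) = (if p = q then 1 else 0)"
proof -
  define E where "E = mat n n (\<lambda>(p,k). e k p)"
  define F where "F = mat n n (\<lambda>(k,p). cnj (e k p))"
  have c: "E \<in> carrier_mat n n" "F \<in> carrier_mat n n" by (auto simp: E_def F_def)
  have "F * E = 1\<^sub>m n"
    by (rule eq_matI) (use o in \<open>auto simp: E_def F_def scalar_prod_def ip_def lessThan_atLeast0\<close>)
  from mat_mult_left_right_inverse[OF c(2,1) this] have "E * F = 1\<^sub>m n" .
  from arg_cong[OF this, of "\<lambda>M. M $$ (p,q)"] show ?thesis
    using assms(2,3) by (auto simp: E_def F_def scalar_prod_def lessThan_atLeast0)
qed

text \<open>Inserts the resolution of the identity by the basis \<open>e\<close> to the right of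
  \<open>A\<close>, writing \<open>A\<close> as a sum of rank-one terms.\<close>

lemma orthonormal_expand:
  assumes o: "\<And>i j. i < n \<Longrightarrow> j < n \<Longrightarrow> ip n (e i) (e j) = (if i = j then 1 else 0)"
    and "q < n"
  shows "(\<Sum>k<n. mv n A (e k) p * cnj (e k q)) = A p q"
proof -
  have "(\<Sum>k<n. mv n A (e k) p * cnj (e k q)) = (\<Sum>k<n. \<Sum>r<n. A p r * (e k r * cnj (e k q)))"
    by (simp add: mv_def sum_distrib_left mult_ac)
  also have "\<dots> = (\<Sum>r<n. \<Sum>k<n. A p r * (e k r * cnj (e k q)))" by (rule sum.swap)
  also have "\<dots> = (\<Sum>r<n. if r = q then A p q else 0)"
    unfolding sum_distrib_left[symmetric]
    by (intro sum.cong refl) (auto simp: orthonormal_complete[OF o _ \<open>q < n\<close>])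
  finally show ?thesis using \<open>q < n\<close> by simp
qed

lemma psd_ip_nonneg:
  assumes "psd n M"
  shows "0 \<le> Re (ip n x (mv n (\<lambda>p q. M $$ (p,q)) x))"
proof -
  have M: "M \<in> carrier_mat n n" using assms by (simp add: psd_def)
  have "0 \<le> Re (conjugate (vec n x) \<bullet> (M *\<^sub>v vec n x))"
    using assms unfolding psd_def by auto
  also have "conjugate (vec n x) \<bullet> (M *\<^sub>v vec n x) = ip n x (mv n (\<lambda>p q. M $$ (p,q)) x)"
    using M by (simp add: scalar_prod_def ip_def mv_def lessThan_atLeast0)
  finally show ?thesis .
qed

lemma psd_herm: "psd n M \<Longrightarrow> herm_fun n (\<lambda>p q. M $$ (p,q))"
  unfolding psd_def herm_fun_def by (metis carrier_matD index_adj)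

text \<open>The eigenvalue \<open>l j\<close> is the value of the quadratic form of \<open>M\<close>
  at the unit vector \<open>e j\<close>, hence nonnegative.\<close>

lemma psd_spectral:
  assumes "psd n M"
  obtains e and l :: "nat \<Rightarrow> real" where
    "\<And>i j. i < n \<Longrightarrow> j < n \<Longrightarrow> ip n (e i) (e j) = (if i = j then 1 else 0)"
    "\<And>j p. j < n \<Longrightarrow> p < n \<Longrightarrow> mv n (\<lambda>p q. M $$ (p,q)) (e j) p = complex_of_real (l j) * e j p"
    "\<And>j. j < n \<Longrightarrow> 0 \<le> l j"
proof -
  let ?A = "\<lambda>p q. M $$ (p,q)"
  obtain e l where
    o: "\<forall>i<n. \<forall>j<n. ip n (e i) (e j) = (if i = j then 1 else 0)" and
    v: "\<forall>j<n. \<forall>p<n. mv n ?A (e j) p = complex_of_real (l j) * e j p"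
    using orthonormal_eigenvectors[OF psd_herm[OF assms] order_refl] by blast
  have "0 \<le> l j" if "j < n" for j
  proof -
    have "ip n (e j) (mv n ?A (e j)) = complex_of_real (l j) * ip n (e j) (e j)"
      by (subst ip_cong[OF refl]) (use v that in \<open>auto simp: ip_scale_right\<close>)
    then show ?thesis using psd_ip_nonneg[OF assms, of "e j"] o that by simp
  qed
  then show thesis using that o v by blast
qed

section \<open>Trace norm and diamond norm\<close>

abbreviation entries :: "complex mat \<Rightarrow> nat \<Rightarrow> nat \<Rightarrow> complex" where
  "entries A \<equiv> \<lambda>p q. A $$ (p,q)"

lemma mv_cong: "(\<And>q. q < n \<Longrightarrow> A p q = B p q) \<Longrightarrow> (\<And>q. q < n \<Longrightarrow> x q = y q) \<Longrightarrow> mv n A x p = mv n B y p"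
  unfolding mv_def by auto

lemma mv_scale: "mv n A (\<lambda>p. c * x p) p = c * mv n A x p"
  by (simp add: mv_def sum_distrib_left mult_ac)

lemma mv_diff: "mv n A (\<lambda>p. x p - y p) p = mv n A x p - mv n A y p"
  by (simp add: mv_def algebra_simps sum_subtractf)

lemma mv_mult:
  assumes "A \<in> carrier_mat n n" "B \<in> carrier_mat n n" "p < n"
  shows "mv n (entries (A * B)) x p = mv n (entries A) (mv n (entries B) x) p"
proof -
  have "mv n (entries (A * B)) x p = (\<Sum>q<n. \<Sum>r<n. A $$ (p,r) * B $$ (r,q) * x q)"
    unfolding mv_def using assms
    by (intro sum.cong refl) (simp add: index_mult_sum[of A n n B n] sum_distrib_right del: index_mult_mat)
  also have "\<dots> = (\<Sum>r<n. \<Sum>q<n. A $$ (p,r) * B $$ (r,q) * x q)"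
    by (rule sum.swap)
  also have "\<dots> = mv n (entries A) (mv n (entries B) x) p"
    by (simp add: mv_def sum_distrib_left mult_ac)
  finally show ?thesis .
qed

lemma eq_mat_on_basis:
  assumes "A \<in> carrier_mat n n" "B \<in> carrier_mat n n"
    and o: "\<And>i j. i < n \<Longrightarrow> j < n \<Longrightarrow> ip n (e i) (e j) = (if i = j then 1 else 0)"
    and eq: "\<And>k p. k < n \<Longrightarrow> p < n \<Longrightarrow> mv n (entries A) (e k) p = mv n (entries B) (e k) p"
  shows "A = B"
proof (rule eq_matI)
  fix i j assume "i < dim_row B" "j < dim_col B"
  then have ij: "i < n" "j < n" using assms by auto
  have "(\<Sum>k<n. mv n (entries A) (e k) i * cnj (e k j)) = (\<Sum>k<n. mv n (entries B) (e k) i * cnj (e k j))"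
    using eq ij by auto
  then show "A $$ (i,j) = B $$ (i,j)"
    using orthonormal_expand[OF o ij(2)] by simp
qed (use assms in auto)

lemma psdI:
  assumes "M \<in> carrier_mat n n" "herm_fun n (entries M)"
    and "\<And>x. 0 \<le> Re (ip n x (mv n (entries M) x))"
  shows "psd n M"
  unfolding psd_def
proof (intro conjI ballI)
  show "adj M = M"
    by (rule eq_matI) (use assms(1) herm_funD[OF assms(2)] in auto)
  fix v :: "complex vec" assume v: "v \<in> carrier_vec n"
  have "conjugate v \<bullet> (M *\<^sub>v v) = ip n (($) v) (mv n (entries M) (($) v))"
    using v assms(1) by (simp add: scalar_prod_def ip_def mv_def lessThan_atLeast0)
  then show "0 \<le> Re (conjugate v \<bullet> (M *\<^sub>v v))" using assms(3) by simp
qed (rule assms)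

lemma gram_ip:
  assumes X: "X \<in> carrier_mat n n"
  shows "ip n (mv n (entries X) x) (mv n (entries X) y) = ip n x (mv n (entries (adj X * X)) y)"
proof -
  have "mv n (entries (adj X * X)) y p = mv n (\<lambda>p q. cnj (X $$ (q,p))) (mv n (entries X) y) p" if "p < n" for p
    unfolding mv_mult[OF adj_carrier[OF X] X that]
    by (rule mv_cong) (use X that in auto)
  then show ?thesis unfolding ip_mv_left by (intro ip_cong) auto
qed

lemma psd_gram:
  assumes X: "X \<in> carrier_mat n n"
  shows "psd n (adj X * X)"
proof (rule psdI)
  show "adj X * X \<in> carrier_mat n n" using adj_carrier[OF X] X by auto
  show "herm_fun n (entries (adj X * X))"
    unfolding herm_fun_def using X adj_carrier[OF X]
    by (auto simp: index_mult_sum[of "adj X" n n X n] mult.commute simp del: index_mult_mat)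
  show "0 \<le> Re (ip n x (mv n (entries (adj X * X)) x))" for x
    unfolding gram_ip[OF X, symmetric] ip_self by simp
qed

text \<open>The defect \<open>w = T v - sqrt l * v\<close> satisfies
  \<open>T w = - sqrt l * w\<close>, which positivity of \<open>T\<close> permits only for
  \<open>w = 0\<close> when \<open>l > 0\<close>. For \<open>l = 0\<close> the squared norm of
  \<open>T v\<close> is the inner product of \<open>v\<close> with \<open>T (T v) = 0\<close>. This
  yields uniqueness of the positive square root.\<close>

lemma psd_root_on_eigenvector:
  assumes T: "psd n T" and eig: "\<And>p. p < n \<Longrightarrow> mv n (entries (T * T)) v p = complex_of_real l * v p"
    and "0 \<le> l" "p < n"
  shows "mv n (entries T) v p = complex_of_real (sqrt l) * v p"
proof -
  let ?T = "entries T"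
  define y where "y = mv n ?T v"
  define w where "w p = y p - complex_of_real (sqrt l) * v p" for p
  have Tc: "T \<in> carrier_mat n n" using T by (simp add: psd_def)
  have Ty: "mv n ?T y p = complex_of_real l * v p" if "p < n" for p
    unfolding y_def using eig[OF that] mv_mult[OF Tc Tc that] by simp
  have ll: "complex_of_real (sqrt l) * complex_of_real (sqrt l) = complex_of_real l"
    using \<open>0 \<le> l\<close> by (metis of_real_mult real_sqrt_mult_self abs_of_nonneg)
  have Tw: "mv n ?T w p = complex_of_real (- sqrt l) * w p" if "p < n" for p
  proof -
    have "mv n ?T w p = complex_of_real l * v p - complex_of_real (sqrt l) * y p"
      unfolding w_def[abs_def] mv_diff mv_scale Ty[OF that] by (simp add: y_def)
    also have "\<dots> = complex_of_real (- sqrt l) * w p"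
      unfolding w_def ll[symmetric] by (simp add: algebra_simps)
    finally show ?thesis .
  qed
  have w0: "nrm n w = 0"
  proof (cases "l = 0")
    case True
    then have "w = y" by (auto simp: w_def)
    have "ip n y y = ip n v (mv n ?T y)"
      unfolding y_def by (rule ip_mv_herm[OF psd_herm[OF T]])
    also have "\<dots> = ip n v (\<lambda>p. 0)"
      by (rule ip_cong) (use Ty True in auto)
    finally show ?thesis unfolding \<open>w = y\<close> by (simp add: ip_self ip_def)
  next
    case False
    have "ip n w (mv n ?T w) = complex_of_real (- sqrt l) * ip n w w"
      by (subst ip_cong[OF refl Tw]) (simp_all add: ip_def sum_distrib_left mult_ac)
    then have "0 \<le> - sqrt l * (nrm n w)\<^sup>2"
      using psd_ip_nonneg[OF T, of w] by (simp add: ip_self)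
    then show ?thesis using False \<open>0 \<le> l\<close>
      by (simp add: mult_le_0_iff)
  qed
  from nrm_eq_0[OF w0 \<open>p < n\<close>] show ?thesis by (simp add: w_def y_def)
qed

section \<open>The trace norm through singular values\<close>

text \<open>The operator \<open>S\<close> scaling each \<open>e k\<close> by
  \<open>sqrt (l k)\<close> is a positive square root of \<open>adj X * X\<close>, and every other
  one agrees with it on the eigenbasis. So the definite description in \<open>trace_norm\<close>
  denotes \<open>S\<close>.\<close>

lemma trace_norm_eq:
  assumes X: "X \<in> carrier_mat n n"
    and o: "\<And>i j. i < n \<Longrightarrow> j < n \<Longrightarrow> ip n (e i) (e j) = (if i = j then 1 else 0)"
    and eig: "\<And>j p. j < n \<Longrightarrow> p < n \<Longrightarrow> mv n (entries (adj X * X)) (e j) p = complex_of_real (l j) * e j p"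
    and l: "\<And>j. j < n \<Longrightarrow> 0 \<le> l j"
  shows "trace_norm X = (\<Sum>k<n. sqrt (l k))"
proof -
  define S where "S = mat n n (\<lambda>(p,q). \<Sum>k<n. complex_of_real (sqrt (l k)) * e k p * cnj (e k q))"
  have S: "S \<in> carrier_mat n n" by (simp add: S_def)
  have mvS: "mv n (entries S) x p = (\<Sum>k<n. complex_of_real (sqrt (l k)) * ip n (e k) x * e k p)" if "p < n" for x p
  proof -
    have "mv n (entries S) x p = (\<Sum>q<n. \<Sum>k<n. complex_of_real (sqrt (l k)) * e k p * cnj (e k q) * x q)"
      using that by (simp add: mv_def S_def sum_distrib_right)
    also have "\<dots> = (\<Sum>k<n. \<Sum>q<n. complex_of_real (sqrt (l k)) * e k p * cnj (e k q) * x q)"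
      by (rule sum.swap)
    finally show ?thesis by (simp add: ip_def sum_distrib_left sum_distrib_right mult_ac)
  qed
  have Se: "mv n (entries S) (e j) p = complex_of_real (sqrt (l j)) * e j p" if "j < n" "p < n" for j p
  proof -
    have "mv n (entries S) (e j) p = (\<Sum>k<n. if k = j then complex_of_real (sqrt (l j)) * e j p else 0)"
      unfolding mvS[OF that(2)] using that by (intro sum.cong) (auto simp: o)
    then show ?thesis using that by simp
  qed
  have psdS: "psd n S"
  proof (rule psdI[OF S])
    show "herm_fun n (entries S)" by (auto simp: herm_fun_def S_def mult_ac)
    fix x
    have "ip n x (mv n (entries S) x) = ip n x (\<lambda>p. \<Sum>k<n. complex_of_real (sqrt (l k)) * ip n (e k) x * e k p)"
      by (rule ip_cong) (auto simp: mvS)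
    also have "\<dots> = (\<Sum>k<n. complex_of_real (sqrt (l k)) * (ip n (e k) x * cnj (ip n (e k) x)))"
      unfolding ip_sum_right ip_scale_right by (simp add: cnj_ip mult_ac)
    also have "\<dots> = complex_of_real (\<Sum>k<n. sqrt (l k) * (cmod (ip n (e k) x))\<^sup>2)"
      unfolding complex_norm_square[symmetric] by simp
    finally show "0 \<le> Re (ip n x (mv n (entries S) x))"
      using l by (auto intro!: sum_nonneg)
  qed
  have "S * S = adj X * X"
  proof (rule eq_mat_on_basis[OF _ _ o])
    fix k p assume kp: "k < n" "p < n"
    have "mv n (entries (S * S)) (e k) p = mv n (entries S) (\<lambda>p. complex_of_real (sqrt (l k)) * e k p) p"
      unfolding mv_mult[OF S S kp(2)] by (rule mv_cong) (use Se kp in auto)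
    also have "\<dots> = complex_of_real (sqrt (l k) * sqrt (l k)) * e k p"
      unfolding mv_scale Se[OF kp] by (simp only: of_real_mult mult.assoc)
    also have "\<dots> = mv n (entries (adj X * X)) (e k) p"
      unfolding real_sqrt_mult_self abs_of_nonneg[OF l[OF kp(1)]] eig[OF kp] ..
    finally show "mv n (entries (S * S)) (e k) p = mv n (entries (adj X * X)) (e k) p" .
  qed (use S X adj_carrier[OF X] in auto)
  moreover have uniq: "T = S" if T: "psd n T" "T * T = adj X * X" for T
  proof (rule eq_mat_on_basis[OF _ S o])
    show "T \<in> carrier_mat n n" using T(1) by (simp add: psd_def)
    fix k p assume kp: "k < n" "p < n"
    show "mv n (entries T) (e k) p = mv n (entries S) (e k) p"
      unfolding Se[OF kp]
      by (rule psd_root_on_eigenvector[OF T(1) _ l[OF kp(1)] kp(2)]) (simp add: T(2) eig[OF kp(1)])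
  qed
  ultimately have "psd n S \<and> S * S = adj X * X" using psdS by blast
  then have "(THE S. psd n S \<and> S * S = adj X * X) = S"
    by (rule the_equality) (elim conjE, rule uniq)
  then have "trace_norm X = Re (mtrace S)" using X by (simp add: trace_norm_def)
  also have "mtrace S = (\<Sum>p<n. \<Sum>k<n. complex_of_real (sqrt (l k)) * e k p * cnj (e k p))"
    by (simp add: mtrace_def S_def)
  also have "\<dots> = (\<Sum>k<n. \<Sum>p<n. complex_of_real (sqrt (l k)) * e k p * cnj (e k p))"
    by (rule sum.swap)
  also have "\<dots> = (\<Sum>k<n. complex_of_real (sqrt (l k)) * ip n (e k) (e k))"
    by (simp add: ip_def sum_distrib_left mult_ac)
  also have "\<dots> = complex_of_real (\<Sum>k<n. sqrt (l k))" by (simp add: o)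
  finally show ?thesis by simp
qed

text \<open>An unnormalized singular value decomposition: over an eigenbasis of
  \<open>adj X * X\<close> take \<open>X e k\<close> and \<open>e k\<close>, whose norms are the
  singular value and \<open>1\<close>.\<close>

lemma trace_norm_attained:
  assumes X: "X \<in> carrier_mat n n"
  shows "\<exists>x y. (\<forall>p<n. \<forall>q<n. X $$ (p,q) = (\<Sum>k<n. x k p * cnj (y k q))) \<and>
    (\<Sum>k<n. nrm n (x k) * nrm n (y k)) = trace_norm X"
proof -
  obtain e l where
    o: "\<And>i j. i < n \<Longrightarrow> j < n \<Longrightarrow> ip n (e i) (e j) = (if i = j then 1 else 0)" and
    eig: "\<And>j p. j < n \<Longrightarrow> p < n \<Longrightarrow> mv n (entries (adj X * X)) (e j) p = complex_of_real (l j) * e j p" and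
    l: "\<And>j. j < n \<Longrightarrow> 0 \<le> l j"
    using psd_spectral[OF psd_gram[OF X]] by metis
  have ne: "nrm n (e k) = 1" if "k < n" for k
  proof -
    have "complex_of_real ((nrm n (e k))\<^sup>2) = 1" using o[OF that that] by (simp add: ip_self)
    then have "(nrm n (e k))\<^sup>2 = 1" using of_real_eq_1_iff by blast
    then show ?thesis using nrm_nonneg[of n "e k"] by (simp add: power2_eq_1_iff)
  qed
  have nX: "nrm n (mv n (entries X) (e k)) = sqrt (l k)" if "k < n" for k
  proof -
    have "complex_of_real ((nrm n (mv n (entries X) (e k)))\<^sup>2) = ip n (e k) (\<lambda>p. complex_of_real (l k) * e k p)"
      unfolding ip_self[symmetric] gram_ip[OF X] by (rule ip_cong) (use eig that in auto)
    also have "\<dots> = complex_of_real (l k)" using o[OF that that] by (simp add: ip_scale_right)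
    finally have "(nrm n (mv n (entries X) (e k)))\<^sup>2 = l k" using of_real_eq_iff by blast
    then show ?thesis by (metis nrm_nonneg real_sqrt_unique)
  qed
  have tn: "trace_norm X = (\<Sum>k<n. sqrt (l k))" by (rule trace_norm_eq[OF X o eig l])
  show ?thesis
  proof (rule exI[of _ "\<lambda>k. mv n (entries X) (e k)"], rule exI[of _ e], intro conjI allI impI)
    fix p q assume "p < n" "q < n"
    then show "X $$ (p,q) = (\<Sum>k<n. mv n (entries X) (e k) p * cnj (e k q))"
      using orthonormal_expand[OF o, where A = "entries X"] by simp
  next
    show "(\<Sum>k<n. nrm n (mv n (entries X) (e k)) * nrm n (e k)) = trace_norm X"
      unfolding tn by (simp add: nX ne)
  qed
qed

lemma trace_norm_nonneg: "X \<in> carrier_mat n n \<Longrightarrow> 0 \<le> trace_norm X"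
  using trace_norm_attained[of X n] by (metis (no_types, lifting) mult_nonneg_nonneg nrm_nonneg sum_nonneg)

text \<open>The normalized images \<open>g k\<close> of the eigenvectors are orthonormal, and the
  singular value \<open>sqrt (l k)\<close> is the inner product of \<open>g k\<close> with
  \<open>X e k\<close>. Inserting the decomposition of \<open>X\<close> leaves, for each
  \<open>j\<close>, a sum over \<open>k\<close> that Cauchy-Schwarz and two uses of Bessel's
  inequality bound by the product of norms.\<close>

lemma trace_norm_le:
  fixes x y :: "'j \<Rightarrow> nat \<Rightarrow> complex"
  assumes X: "X \<in> carrier_mat n n"
    and dec: "\<And>p q. p < n \<Longrightarrow> q < n \<Longrightarrow> X $$ (p,q) = (\<Sum>j\<in>J. x j p * cnj (y j q))"
  shows "trace_norm X \<le> (\<Sum>j\<in>J. nrm n (x j) * nrm n (y j))"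
proof -
  obtain e l where
    o: "\<And>i j. i < n \<Longrightarrow> j < n \<Longrightarrow> ip n (e i) (e j) = (if i = j then 1 else 0)" and
    eig: "\<And>j p. j < n \<Longrightarrow> p < n \<Longrightarrow> mv n (entries (adj X * X)) (e j) p = complex_of_real (l j) * e j p" and
    l: "\<And>j. j < n \<Longrightarrow> 0 \<le> l j"
    using psd_spectral[OF psd_gram[OF X]] by metis
  \<comment> \<open>Only nonzero singular values are kept, since \<open>g k\<close> divides by
    them.\<close>
  define K where "K = {k. k < n \<and> l k \<noteq> 0}"
  have K: "finite K" by (simp add: K_def)
  define g where "g k p = complex_of_real (1 / sqrt (l k)) * mv n (entries X) (e k) p" for k p
  have XX: "ip n (mv n (entries X) (e i)) (mv n (entries X) (e j)) = (if i = j then complex_of_real (l j) else 0)"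
    if "i < n" "j < n" for i j
  proof -
    have "ip n (mv n (entries X) (e i)) (mv n (entries X) (e j)) = ip n (e i) (\<lambda>p. complex_of_real (l j) * e j p)"
      unfolding gram_ip[OF X] by (rule ip_cong) (use eig that in auto)
    then show ?thesis using o[OF that] by (simp add: ip_scale_right)
  qed
  have og: "ip n (g i) (g j) = (if i = j then 1 else 0)" if "i \<in> K" "j \<in> K" for i j
  proof -
    have "ip n (g i) (g j) = complex_of_real (1 / sqrt (l i)) * (complex_of_real (1 / sqrt (l j)) *
       (if i = j then complex_of_real (l j) else 0))"
      unfolding g_def[abs_def] ip_scale_left ip_scale_right using XX that by (simp add: K_def)
    also have "\<dots> = (if i = j then complex_of_real (1 / sqrt (l j) * (1 / sqrt (l j) * l j)) else 0)"
      by (cases "i = j") (simp_all only: of_real_mult if_True if_False mult_zero_right simp_thms)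
    also have "1 / sqrt (l j) * (1 / sqrt (l j) * l j) = 1"
      using that l[of j] by (simp add: K_def field_simps)
    finally show ?thesis by simp
  qed
  have root: "complex_of_real (sqrt (l k)) = (\<Sum>j\<in>J. ip n (g k) (x j) * ip n (y j) (e k))" if "k \<in> K" for k
  proof -
    have kn: "k < n" using that by (simp add: K_def)
    have "ip n (g k) (mv n (entries X) (e k)) = complex_of_real (1 / sqrt (l k) * l k)"
      unfolding g_def[abs_def] ip_scale_left XX[OF kn kn] by simp
    also have "1 / sqrt (l k) * l k = sqrt (l k)"
      using that l[OF kn] by (simp add: real_div_sqrt)
    finally have "complex_of_real (sqrt (l k)) = ip n (g k) (mv n (entries X) (e k))" by simp
    also have "\<dots> = ip n (g k) (\<lambda>p. \<Sum>j\<in>J. ip n (y j) (e k) * x j p)"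
    proof (rule ip_cong[OF refl])
      fix p assume p: "p < n"
      have "mv n (entries X) (e k) p = (\<Sum>q<n. \<Sum>j\<in>J. x j p * cnj (y j q) * e k q)"
        using p by (simp add: mv_def dec sum_distrib_right)
      also have "\<dots> = (\<Sum>j\<in>J. \<Sum>q<n. x j p * cnj (y j q) * e k q)" by (rule sum.swap)
      also have "\<dots> = (\<Sum>j\<in>J. ip n (y j) (e k) * x j p)"
        by (simp add: ip_def sum_distrib_left sum_distrib_right mult_ac)
      finally show "mv n (entries X) (e k) p = (\<Sum>j\<in>J. ip n (y j) (e k) * x j p)" .
    qed
    also have "\<dots> = (\<Sum>j\<in>J. ip n (g k) (x j) * ip n (y j) (e k))"
      unfolding ip_sum_right ip_scale_right by (simp add: mult.commute)
    finally show ?thesis .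
  qed
  have L2g: "L2_set (\<lambda>k. cmod (ip n (g k) z)) K \<le> nrm n z" for z
    unfolding L2_set_def using bessel[OF K og, of z] by (simp add: real_le_lsqrt)
  have oK: "ip n (e i) (e j) = (if i = j then 1 else 0)" if "i \<in> K" "j \<in> K" for i j
    using o that by (simp add: K_def)
  have L2e: "L2_set (\<lambda>k. cmod (ip n z (e k))) K \<le> nrm n z" for z
  proof -
    have "cmod (ip n z (e k)) = cmod (ip n (e k) z)" for k by (metis cnj_ip complex_mod_cnj)
    then show ?thesis
      unfolding L2_set_def using bessel[OF K oK, of z] by (simp add: real_le_lsqrt)
  qed
  have "trace_norm X = (\<Sum>k<n. sqrt (l k))" by (rule trace_norm_eq[OF X o eig l])
  also have "\<dots> = (\<Sum>k\<in>K. sqrt (l k))"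
    by (rule sum.mono_neutral_right) (auto simp: K_def)
  also have "\<dots> \<le> (\<Sum>k\<in>K. \<Sum>j\<in>J. cmod (ip n (g k) (x j)) * cmod (ip n (y j) (e k)))"
  proof (rule sum_mono)
    fix k assume k: "k \<in> K"
    have "sqrt (l k) \<le> cmod (complex_of_real (sqrt (l k)))" by simp
    also have "\<dots> \<le> (\<Sum>j\<in>J. cmod (ip n (g k) (x j)) * cmod (ip n (y j) (e k)))"
      unfolding root[OF k] by (rule order_trans[OF norm_sum]) (simp add: norm_mult)
    finally show "sqrt (l k) \<le> (\<Sum>j\<in>J. cmod (ip n (g k) (x j)) * cmod (ip n (y j) (e k)))" .
  qed
  also have "\<dots> = (\<Sum>j\<in>J. \<Sum>k\<in>K. cmod (ip n (g k) (x j)) * cmod (ip n (y j) (e k)))"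
    by (rule sum.swap)
  also have "\<dots> \<le> (\<Sum>j\<in>J. nrm n (x j) * nrm n (y j))"
  proof (rule sum_mono)
    fix j
    have "(\<Sum>k\<in>K. cmod (ip n (g k) (x j)) * cmod (ip n (y j) (e k)))
       \<le> L2_set (\<lambda>k. cmod (ip n (g k) (x j))) K * L2_set (\<lambda>k. cmod (ip n (y j) (e k))) K"
      using L2_set_mult_ineq[of "\<lambda>k. cmod (ip n (g k) (x j))" "\<lambda>k. cmod (ip n (y j) (e k))" K] by simp
    also have "\<dots> \<le> nrm n (x j) * nrm n (y j)"
      by (intro mult_mono L2g L2e) simp_all
    finally show "(\<Sum>k\<in>K. cmod (ip n (g k) (x j)) * cmod (ip n (y j) (e k))) \<le> nrm n (x j) * nrm n (y j)" .
  qed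
  finally show ?thesis .
qed

lemma trace_norm_zero_le: "trace_norm (0\<^sub>m n n) \<le> 0"
  using trace_norm_le[of "0\<^sub>m n n" n "\<lambda>_ _. 0" "\<lambda>_ _. 0" "{} :: nat set"] by simp

section \<open>Operators on a bipartite space and the diamond norm\<close>

lemma sum_div_mod:
  fixes f :: "nat \<Rightarrow> nat \<Rightarrow> 'a::comm_monoid_add"
  shows "(\<Sum>p<m*r. f (p div r) (p mod r)) = (\<Sum>a<m. \<Sum>b<r. f a b)"
proof -
  have "(\<Sum>p<m*r. f (p div r) (p mod r)) = (\<Sum>a<m. \<Sum>p=a*r..<a*r+r. f (p div r) (p mod r))"
    by (rule sum.nat_group[symmetric])
  also have "\<dots> = (\<Sum>a<m. \<Sum>b<r. f a b)"
  proof (rule sum.cong[OF refl])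
    fix a
    have "(\<Sum>b<r. f a b) = (\<Sum>p=a*r..<a*r+r. f (p div r) (p mod r))"
      by (rule sum.reindex_bij_witness[where j = "\<lambda>b. a*r + b" and i = "\<lambda>p. p - a*r"]) auto
    then show "(\<Sum>p=a*r..<a*r+r. f (p div r) (p mod r)) = (\<Sum>b<r. f a b)" ..
  qed
  finally show ?thesis .
qed

lemma div_mod_less: "p < m * r \<Longrightarrow> p div r < m \<and> p mod r < (r::nat)"
  by (metis less_mult_imp_div_less mod_less_divisor mult_0_right not_gr_zero not_less_zero)

lemma index_combine_less: "a < m \<Longrightarrow> b < r \<Longrightarrow> a * r + b < m * (r::nat)"
proof -
  assume "a < m" "b < r"
  then have "a * r + b < (a + 1) * r" by simp
  also have "\<dots> \<le> m * r" using \<open>a < m\<close> by (intro mult_right_mono) auto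
  finally show ?thesis .
qed

text \<open>Row-major vectorization: the image of the unnormalized maximally entangled vector under
  \<open>A\<close> tensor identity. Its norm is the Frobenius norm of \<open>A\<close>, and
  \<open>ip\<close> becomes the Hilbert-Schmidt inner product.\<close>

definition vecf :: "nat \<Rightarrow> (nat \<Rightarrow> nat \<Rightarrow> complex) \<Rightarrow> nat \<Rightarrow> complex" where
  "vecf n A p = A (p div n) (p mod n)"

lemma ip_vecf: "ip (n*n) (vecf n A) (vecf n B) = (\<Sum>a<n. \<Sum>i<n. cnj (A a i) * B a i)"
  unfolding ip_def vecf_def by (rule sum_div_mod[where f = "\<lambda>a i. cnj (A a i) * B a i"])

lemma nrm_vecf_sq: "(nrm (n*n) (vecf n A))\<^sup>2 = (\<Sum>a<n. \<Sum>i<n. (cmod (A a i))\<^sup>2)"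
  unfolding nrm_sq vecf_def by (rule sum_div_mod[where f = "\<lambda>a i. (cmod (A a i))\<^sup>2"])

text \<open>The action of \<open>A \<otimes> 1\<close> on a vector of \<open>\<complex>\<^sup>n \<otimes> \<complex>\<^sup>n\<close>.\<close>

definition op_ext :: "nat \<Rightarrow> (nat \<Rightarrow> nat \<Rightarrow> complex) \<Rightarrow> (nat \<Rightarrow> complex) \<Rightarrow> nat \<Rightarrow> complex" where
  "op_ext n A x p = (\<Sum>i<n. A (p div n) i * x (i*n + p mod n))"

text \<open>The operator norm is at most the Frobenius norm: Cauchy-Schwarz in the contracted index
  \<open>i\<close> for each row \<open>a\<close> and each ancilla index \<open>r\<close>, then
  summation over both.\<close>

lemma nrm_op_ext: "nrm (n*n) (op_ext n A x) \<le> nrm (n*n) (vecf n A) * nrm (n*n) x"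
proof -
  have cs: "(cmod (\<Sum>i<n. A a i * x (i*n+r)))\<^sup>2 \<le> (\<Sum>i<n. (cmod (A a i))\<^sup>2) * (\<Sum>i<n. (cmod (x (i*n+r)))\<^sup>2)" for a r
  proof -
    have "cmod (\<Sum>i<n. A a i * x (i*n+r)) = cmod (ip n (\<lambda>i. cnj (A a i)) (\<lambda>i. x (i*n+r)))"
      by (simp add: ip_def)
    also have "\<dots> \<le> nrm n (\<lambda>i. cnj (A a i)) * nrm n (\<lambda>i. x (i*n+r))" by (rule cmod_ip_le)
    finally have "(cmod (\<Sum>i<n. A a i * x (i*n+r)))\<^sup>2 \<le> (nrm n (\<lambda>i. cnj (A a i)) * nrm n (\<lambda>i. x (i*n+r)))\<^sup>2"
      by (rule power_mono) simp
    then show ?thesis by (simp add: power_mult_distrib nrm_sq)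
  qed
  have "(nrm (n*n) (op_ext n A x))\<^sup>2 = (\<Sum>a<n. \<Sum>r<n. (cmod (\<Sum>i<n. A a i * x (i*n+r)))\<^sup>2)"
    unfolding nrm_sq op_ext_def
    by (rule sum_div_mod[where f = "\<lambda>a r. (cmod (\<Sum>i<n. A a i * x (i*n+r)))\<^sup>2"])
  also have "\<dots> \<le> (\<Sum>a<n. \<Sum>r<n. (\<Sum>i<n. (cmod (A a i))\<^sup>2) * (\<Sum>i<n. (cmod (x (i*n+r)))\<^sup>2))"
    by (intro sum_mono cs)
  also have "\<dots> = (\<Sum>a<n. \<Sum>i<n. (cmod (A a i))\<^sup>2) * (\<Sum>r<n. \<Sum>i<n. (cmod (x (i*n+r)))\<^sup>2)"
    by (simp add: sum_product)
  also have "(\<Sum>r<n. \<Sum>i<n. (cmod (x (i*n+r)))\<^sup>2) = (\<Sum>i<n. \<Sum>r<n. (cmod (x (i*n+r)))\<^sup>2)"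
    by (rule sum.swap)
  also have "\<dots> = (nrm (n*n) x)\<^sup>2"
    using sum_div_mod[where f = "\<lambda>i r. (cmod (x (i*n+r)))\<^sup>2" and m = n and r = n] by (simp add: nrm_sq)
  also have "(\<Sum>a<n. \<Sum>i<n. (cmod (A a i))\<^sup>2) = (nrm (n*n) (vecf n A))\<^sup>2" by (simp add: nrm_vecf_sq)
  finally have "(nrm (n*n) (op_ext n A x))\<^sup>2 \<le> (nrm (n*n) (vecf n A) * nrm (n*n) x)\<^sup>2"
    by (simp only: power_mult_distrib)
  then show ?thesis by (rule power2_le_imp_le) simp
qed

text \<open>The left and right operators may differ, unlike in a Kraus form. This covers differences
  of channels and leaves freedom in the choice of the representation, on which the norm bound
  depends.\<close>

definition op_sum :: "nat \<Rightarrow> (complex mat \<Rightarrow> complex mat) \<Rightarrow> 'j set \<Rightarrow>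
    ('j \<Rightarrow> nat \<Rightarrow> nat \<Rightarrow> complex) \<Rightarrow> ('j \<Rightarrow> nat \<Rightarrow> nat \<Rightarrow> complex) \<Rightarrow> bool" where
  "op_sum n \<Phi> J A B \<longleftrightarrow> (\<forall>Y\<in>carrier_mat n n. \<forall>a<n. \<forall>b<n.
     \<Phi> Y $$ (a,b) = (\<Sum>j\<in>J. \<Sum>i<n. \<Sum>l<n. A j a i * Y $$ (i,l) * cnj (B j b l)))"

lemma op_sumD: "op_sum n \<Phi> J A B \<Longrightarrow> Y \<in> carrier_mat n n \<Longrightarrow> a < n \<Longrightarrow> b < n \<Longrightarrow>
   \<Phi> Y $$ (a,b) = (\<Sum>j\<in>J. \<Sum>i<n. \<Sum>l<n. A j a i * Y $$ (i,l) * cnj (B j b l))"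
  unfolding op_sum_def by blast

lemma ext_id_carrier: "ext_id \<Phi> n m r X \<in> carrier_mat (m*r) (m*r)"
  by (simp add: ext_id_def)

text \<open>A rank-one term of \<open>X\<close> is sent to one rank-one term for each
  \<open>j\<close>, with \<open>A j\<close> and \<open>B j\<close> acting on its two vectors. A
  decomposition of \<open>X\<close> thus gives one of the image, indexed by pairs.\<close>

lemma index_ext_id:
  assumes op: "op_sum n \<Phi> J A B"
    and dec: "\<And>p q. p < n*n \<Longrightarrow> q < n*n \<Longrightarrow> X $$ (p,q) = (\<Sum>k\<in>K. x k p * cnj (y k q))"
    and pq: "p < n*n" "q < n*n"
  shows "ext_id \<Phi> n n n X $$ (p,q) =
    (\<Sum>(j,k)\<in>J\<times>K. op_ext n (A j) (x k) p * cnj (op_ext n (B j) (y k) q))"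
proof -
  have lt: "p div n < n" "q div n < n" "p mod n < n" "q mod n < n"
    using div_mod_less pq by auto
  have "ext_id \<Phi> n n n X $$ (p,q) =
     (\<Sum>j\<in>J. \<Sum>i<n. \<Sum>l<n. A j (p div n) i * X $$ (i*n + p mod n, l*n + q mod n) * cnj (B j (q div n) l))"
    using pq lt by (simp add: ext_id_def op_sumD[OF op])
  also have "\<dots> = (\<Sum>j\<in>J. \<Sum>i<n. \<Sum>l<n. \<Sum>k\<in>K.
      A j (p div n) i * x k (i*n + p mod n) * cnj (B j (q div n) l * y k (l*n + q mod n)))"
    using lt by (intro sum.cong refl)
      (simp add: dec index_combine_less sum_distrib_left sum_distrib_right mult_ac)
  also have "\<dots> = (\<Sum>j\<in>J. \<Sum>k\<in>K. \<Sum>i<n. \<Sum>l<n.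
      A j (p div n) i * x k (i*n + p mod n) * cnj (B j (q div n) l * y k (l*n + q mod n)))"
    (is "_ = (\<Sum>j\<in>J. ?R j)")
  proof (rule sum.cong[OF refl])
    fix j
    have "(\<Sum>i<n. \<Sum>l<n. \<Sum>k\<in>K.
      A j (p div n) i * x k (i*n + p mod n) * cnj (B j (q div n) l * y k (l*n + q mod n)))
      = (\<Sum>i<n. \<Sum>k\<in>K. \<Sum>l<n.
      A j (p div n) i * x k (i*n + p mod n) * cnj (B j (q div n) l * y k (l*n + q mod n)))"
      by (intro sum.cong[OF refl] sum.swap)
    also have "\<dots> = ?R j" by (rule sum.swap)
    finally show "(\<Sum>i<n. \<Sum>l<n. \<Sum>k\<in>K.
      A j (p div n) i * x k (i*n + p mod n) * cnj (B j (q div n) l * y k (l*n + q mod n))) = ?R j" .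
  qed
  also have "\<dots> = (\<Sum>j\<in>J. \<Sum>k\<in>K. op_ext n (A j) (x k) p * cnj (op_ext n (B j) (y k) q))"
    by (simp add: op_ext_def sum_product)
  finally show ?thesis by (simp add: sum.cartesian_product)
qed

text \<open>An optimal decomposition of \<open>X\<close> is pushed through the map; the resulting
  decomposition bounds the trace norm of the image, with each vector controlled by
  \<open>nrm_op_ext\<close>.\<close>

lemma trace_norm_ext_id_le:
  assumes op: "op_sum n \<Phi> J A B" and X: "X \<in> carrier_mat (n*n) (n*n)"
  shows "trace_norm (ext_id \<Phi> n n n X) \<le>
    (\<Sum>j\<in>J. nrm (n*n) (vecf n (A j)) * nrm (n*n) (vecf n (B j))) * trace_norm X"
proof -
  obtain x y where dec: "\<forall>p<n*n. \<forall>q<n*n. X $$ (p,q) = (\<Sum>k<n*n. x k p * cnj (y k q))"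
    and tn: "(\<Sum>k<n*n. nrm (n*n) (x k) * nrm (n*n) (y k)) = trace_norm X"
    using trace_norm_attained[OF X] by blast
  have "trace_norm (ext_id \<Phi> n n n X) \<le> (\<Sum>jk\<in>J\<times>{..<n*n}.
      nrm (n*n) (op_ext n (A (fst jk)) (x (snd jk))) * nrm (n*n) (op_ext n (B (fst jk)) (y (snd jk))))"
  proof (rule trace_norm_le[OF ext_id_carrier])
    fix p q assume "p < n*n" "q < n*n"
    then show "ext_id \<Phi> n n n X $$ (p,q) = (\<Sum>jk\<in>J\<times>{..<n*n}.
       op_ext n (A (fst jk)) (x (snd jk)) p * cnj (op_ext n (B (fst jk)) (y (snd jk)) q))"
      using index_ext_id[OF op, where X = X and K = "{..<n*n}" and x = x and y = y] dec by (simp add: case_prod_unfold)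
  qed
  also have "\<dots> \<le> (\<Sum>jk\<in>J\<times>{..<n*n}. (nrm (n*n) (vecf n (A (fst jk))) * nrm (n*n) (x (snd jk))) *
      (nrm (n*n) (vecf n (B (fst jk))) * nrm (n*n) (y (snd jk))))"
    by (intro sum_mono mult_mono nrm_op_ext) simp_all
  also have "\<dots> = (\<Sum>j\<in>J. \<Sum>k<n*n. (nrm (n*n) (vecf n (A j)) * nrm (n*n) (vecf n (B j))) *
      (nrm (n*n) (x k) * nrm (n*n) (y k)))"
    by (simp add: sum.cartesian_product case_prod_unfold mult_ac)
  also have "\<dots> = (\<Sum>j\<in>J. nrm (n*n) (vecf n (A j)) * nrm (n*n) (vecf n (B j))) * trace_norm X"
    unfolding tn[symmetric] by (simp add: sum_product)
  finally show ?thesis .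
qed

text \<open>One uniform bound serves both claims: it bounds the supremum, and it shows that the set
  is bounded above, without which a member could not be compared with its
  \<open>Sup\<close>.\<close>

lemma
  assumes op: "op_sum n \<Phi> J A B"
  shows diamond_norm_le: "diamond_norm \<Phi> n n \<le> (\<Sum>j\<in>J. nrm (n*n) (vecf n (A j)) * nrm (n*n) (vecf n (B j)))"
    and trace_norm_le_diamond: "X \<in> carrier_mat (n*n) (n*n) \<Longrightarrow> trace_norm X \<le> 1 \<Longrightarrow>
      trace_norm (ext_id \<Phi> n n n X) \<le> diamond_norm \<Phi> n n"
proof -
  let ?c = "\<Sum>j\<in>J. nrm (n*n) (vecf n (A j)) * nrm (n*n) (vecf n (B j))"
  let ?S = "{trace_norm (ext_id \<Phi> n n n X) | X. X \<in> carrier_mat (n*n) (n*n) \<and> trace_norm X \<le> 1}"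
  have c: "0 \<le> ?c" by (intro sum_nonneg mult_nonneg_nonneg) simp_all
  have bd: "s \<le> ?c" if s: "s \<in> ?S" for s
  proof -
    from s obtain X where X: "s = trace_norm (ext_id \<Phi> n n n X)" "X \<in> carrier_mat (n*n) (n*n)" "trace_norm X \<le> 1"
      by blast
    have "s \<le> ?c * trace_norm X" unfolding X(1) by (rule trace_norm_ext_id_le[OF op X(2)])
    also have "\<dots> \<le> ?c * 1" by (rule mult_left_mono[OF X(3) c])
    finally show ?thesis by simp
  qed
  have ne: "?S \<noteq> {}"
    using trace_norm_zero_le[of "n*n"] by (auto intro!: exI[of _ "0\<^sub>m (n*n) (n*n)"])
  show "diamond_norm \<Phi> n n \<le> ?c"
    unfolding diamond_norm_def by (rule cSup_least[OF ne bd])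
  show "trace_norm (ext_id \<Phi> n n n X) \<le> diamond_norm \<Phi> n n"
    if "X \<in> carrier_mat (n*n) (n*n)" "trace_norm X \<le> 1"
    unfolding diamond_norm_def by (rule cSup_upper) (use that bd in \<open>auto intro!: bdd_aboveI[of _ ?c]\<close>)
qed

section \<open>Diamond norm versus entanglement fidelity\<close>

lemma msum_carrier: "(\<And>M. M \<in> set Ms \<Longrightarrow> M \<in> carrier_mat n n) \<Longrightarrow> msum n Ms \<in> carrier_mat n n"
  unfolding msum_def by (induction Ms) auto

lemma msum_Nil [simp]: "msum n [] = 0\<^sub>m n n" and msum_Cons [simp]: "msum n (M # Ms) = M + msum n Ms"
  by (simp_all add: msum_def)

lemma index_msum:
  assumes "\<And>M. M \<in> set Ms \<Longrightarrow> M \<in> carrier_mat n n" "a < n" "b < n"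
  shows "msum n Ms $$ (a,b) = (\<Sum>M\<leftarrow>Ms. M $$ (a,b))"
  using assms(1)
proof (induction Ms)
  case (Cons M Ms)
  then have "msum n Ms \<in> carrier_mat n n" by (intro msum_carrier) auto
  with Cons assms show ?case by auto
qed (use assms in simp)

lemma sandwich_carrier: "K \<in> carrier_mat m n \<Longrightarrow> X \<in> carrier_mat n n \<Longrightarrow> K * X * adj K \<in> carrier_mat m m"
  by (meson mult_carrier_mat adj_carrier)

lemma gram_carrier: "K \<in> carrier_mat m n \<Longrightarrow> adj K * K \<in> carrier_mat n n"
  by (meson mult_carrier_mat adj_carrier)

lemma index_sandwich:
  assumes "K \<in> carrier_mat m n" "X \<in> carrier_mat n n" "a < m" "b < m"
  shows "(K * X * adj K) $$ (a,b) = (\<Sum>i<n. \<Sum>l<n. K $$ (a,i) * X $$ (i,l) * cnj (K $$ (b,l)))"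
proof -
  have "(K * X * adj K) $$ (a,b) = (\<Sum>l<n. (K * X) $$ (a,l) * adj K $$ (l,b))"
    by (rule index_mult_sum[OF mult_carrier_mat[OF assms(1,2)] adj_carrier[OF assms(1)] assms(3,4)])
  also have "\<dots> = (\<Sum>l<n. \<Sum>i<n. K $$ (a,i) * X $$ (i,l) * cnj (K $$ (b,l)))"
  proof (rule sum.cong[OF refl])
    fix l assume "l \<in> {..<n}"
    then have "(K * X) $$ (a,l) = (\<Sum>i<n. K $$ (a,i) * X $$ (i,l))"
      by (intro index_mult_sum[OF assms(1,2,3)]) simp
    then show "(K * X) $$ (a,l) * adj K $$ (l,b) = (\<Sum>i<n. K $$ (a,i) * X $$ (i,l) * cnj (K $$ (b,l)))"
      using assms \<open>l \<in> {..<n}\<close> by (simp add: sum_distrib_right)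
  qed
  also have "\<dots> = (\<Sum>i<n. \<Sum>l<n. K $$ (a,i) * X $$ (i,l) * cnj (K $$ (b,l)))"
    by (rule sum.swap)
  finally show ?thesis .
qed

lemma sum_list_map_nth: "(\<Sum>x\<leftarrow>xs. f x) = (\<Sum>j<length xs. f (xs ! j))"
  by (simp add: sum_list_sum_nth lessThan_atLeast0)

lemma index_apply_kraus:
  assumes "\<And>K. K \<in> set Ks \<Longrightarrow> K \<in> carrier_mat m n" "X \<in> carrier_mat n n" "a < m" "b < m"
  shows "apply_kraus m Ks X $$ (a,b) =
    (\<Sum>j<length Ks. \<Sum>i<n. \<Sum>l<n. (Ks!j) $$ (a,i) * X $$ (i,l) * cnj ((Ks!j) $$ (b,l)))"
proof -
  have "apply_kraus m Ks X $$ (a,b) = (\<Sum>K\<leftarrow>Ks. (K * X * adj K) $$ (a,b))"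
    unfolding apply_kraus_def
    by (subst index_msum) (use assms in \<open>auto simp: o_def intro!: sandwich_carrier\<close>)
  also have "\<dots> = (\<Sum>j<length Ks. (Ks!j * X * adj (Ks!j)) $$ (a,b))" by (rule sum_list_map_nth)
  also have "\<dots> = (\<Sum>j<length Ks. \<Sum>i<n. \<Sum>l<n. (Ks!j) $$ (a,i) * X $$ (i,l) * cnj ((Ks!j) $$ (b,l)))"
    using assms by (intro sum.cong refl index_sandwich) auto
  finally show ?thesis .
qed

lemma apply_kraus_carrier:
  assumes "\<And>K. K \<in> set Ks \<Longrightarrow> K \<in> carrier_mat m n" "X \<in> carrier_mat n n"
  shows "apply_kraus m Ks X \<in> carrier_mat m m"
  unfolding apply_kraus_def by (rule msum_carrier) (use assms in \<open>auto intro!: sandwich_carrier\<close>)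

abbreviation mvec :: "nat \<Rightarrow> complex mat \<Rightarrow> nat \<Rightarrow> complex" where
  "mvec n A \<equiv> vecf n (entries A)"

lemma mtrace_gram:
  assumes "K \<in> carrier_mat n n"
  shows "mtrace (adj K * K) = complex_of_real ((nrm (n*n) (mvec n K))\<^sup>2)"
proof -
  have "mtrace (adj K * K) = (\<Sum>i<n. \<Sum>a<n. cnj (K $$ (a,i)) * K $$ (a,i))"
    using assms adj_carrier[OF assms]
    by (simp add: mtrace_def index_mult_sum[of "adj K" n n K n] del: index_mult_mat(1))
  also have "\<dots> = (\<Sum>a<n. \<Sum>i<n. cnj (K $$ (a,i)) * K $$ (a,i))" by (rule sum.swap)
  also have "\<dots> = ip (n*n) (mvec n K) (mvec n K)" by (simp add: ip_vecf)
  finally show ?thesis by (simp only: ip_self)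
qed

lemma mtrace_one: "mtrace (1\<^sub>m n) = of_nat n"
  by (simp add: mtrace_def)

lemma mtrace_msum:
  assumes "\<And>M. M \<in> set Ms \<Longrightarrow> M \<in> carrier_mat n n"
  shows "mtrace (msum n Ms) = (\<Sum>M\<leftarrow>Ms. mtrace M)"
  using assms
proof (induction Ms)
  case (Cons M Ms)
  then have "msum n Ms \<in> carrier_mat n n" "M \<in> carrier_mat n n" by (auto intro: msum_carrier)
  then have "mtrace (M + msum n Ms) = mtrace M + mtrace (msum n Ms)"
    by (simp add: mtrace_def sum.distrib)
  with Cons show ?case by simp
qed (simp add: mtrace_def)

lemma unitary_nrm:
  assumes "unitary_mat n U" shows "(nrm (n*n) (mvec n U))\<^sup>2 = real n"
proof -
  have "complex_of_real ((nrm (n*n) (mvec n U))\<^sup>2) = of_nat n"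
    using assms mtrace_gram[of U n] by (simp add: unitary_mat_def mtrace_one)
  then show ?thesis by (metis of_real_eq_iff of_real_of_nat_eq)
qed

text \<open>This is the trace of the normalization condition in
  \<open>kraus_channel\<close>.\<close>

lemma kraus_nrm:
  assumes "kraus_channel n n Ks"
  shows "(\<Sum>j<length Ks. (nrm (n*n) (mvec n (Ks!j)))\<^sup>2) = real n"
proof -
  have K: "\<And>K. K \<in> set Ks \<Longrightarrow> K \<in> carrier_mat n n" and s: "msum n (map (\<lambda>K. adj K * K) Ks) = 1\<^sub>m n"
    using assms by (auto simp: kraus_channel_def)
  have "of_nat n = (\<Sum>M\<leftarrow>map (\<lambda>K. adj K * K) Ks. mtrace M)"
    unfolding mtrace_one[symmetric] s[symmetric]
    by (rule mtrace_msum) (use K in \<open>auto intro!: gram_carrier\<close>)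
  also have "\<dots> = (\<Sum>K\<leftarrow>Ks. mtrace (adj K * K))" by (simp add: o_def)
  also have "\<dots> = (\<Sum>K\<leftarrow>Ks. complex_of_real ((nrm (n*n) (mvec n K))\<^sup>2))"
    by (rule arg_cong[of _ _ sum_list]) (rule map_cong[OF refl], rule mtrace_gram, rule K)
  also have "\<dots> = complex_of_real (\<Sum>j<length Ks. (nrm (n*n) (mvec n (Ks!j)))\<^sup>2)"
    unfolding sum_list_map_nth by simp
  finally have "complex_of_real (real n) = complex_of_real (\<Sum>j<length Ks. (nrm (n*n) (mvec n (Ks!j)))\<^sup>2)"
    by (simp only: of_real_of_nat_eq)
  then show ?thesis by (simp only: of_real_eq_iff)
qed

section \<open>Entanglement fidelity and its two comparisons with the diamond distance\<close>

text \<open>The inner product is the trace of \<open>adj U * K\<close>, so this is the entanglement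
  fidelity: the overlap of the images of the maximally entangled state under the channel and under
  \<open>U\<close>. It is additive over the Kraus list and quadratic in each operator.\<close>

definition fidelity :: "nat \<Rightarrow> complex mat \<Rightarrow> complex mat list \<Rightarrow> real" where
  "fidelity n U Ks = (\<Sum>K\<leftarrow>Ks. (cmod (ip (n*n) (mvec n U) (mvec n K)))\<^sup>2) / (real n)\<^sup>2"

text \<open>\<open>c * u\<close> is the orthogonal projection of \<open>k\<close> onto
  \<open>u\<close>, and \<open>q\<close> is the squared norm of \<open>k\<close> in units of
  \<open>d\<close>; expanding in the inner products of \<open>u\<close> and \<open>k\<close> gives
  both identities. They supply the Frobenius norms of the operators by which a Kraus operator is
  compared with \<open>U\<close>.\<close>

lemma nrm_residual:
  assumes u: "(nrm N u)\<^sup>2 = d" "d > 0" and c: "c = ip N u k / complex_of_real d"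
    and q: "q = (nrm N k)\<^sup>2 / d"
  shows "(nrm N (\<lambda>p. k p - c * u p))\<^sup>2 = d * (q - (cmod c)\<^sup>2)"
    and "(nrm N (\<lambda>p. cnj c * k p - complex_of_real q * u p))\<^sup>2 = d * q * (q - (cmod c)\<^sup>2)"
proof -
  have uk: "ip N u k = complex_of_real d * c" using u c by simp
  then have ku: "ip N k u = complex_of_real d * cnj c" using cnj_ip[of N u k] by simp
  have uu: "ip N u u = complex_of_real d" using u by (simp add: ip_self)
  have kk: "ip N k k = complex_of_real (q * d)" using u q by (simp add: ip_self)
  have "complex_of_real ((nrm N (\<lambda>p. k p - c * u p))\<^sup>2) = complex_of_real (q * d) - complex_of_real d * (c * cnj c)"
    unfolding ip_self[symmetric] ip_diff_left ip_diff_right ip_scale_left ip_scale_right uk ku uu kk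
    by (simp add: algebra_simps)
  also have "\<dots> = complex_of_real (d * (q - (cmod c)\<^sup>2))"
    unfolding complex_norm_square[symmetric] by (simp add: algebra_simps)
  finally show "(nrm N (\<lambda>p. k p - c * u p))\<^sup>2 = d * (q - (cmod c)\<^sup>2)" using of_real_eq_iff by blast
  have "complex_of_real ((nrm N (\<lambda>p. cnj c * k p - complex_of_real q * u p))\<^sup>2)
     = complex_of_real (q * q * d) - complex_of_real (d * q) * (c * cnj c)"
    unfolding ip_self[symmetric] ip_diff_left ip_diff_right ip_scale_left ip_scale_right uk ku uu kk
    by (simp add: algebra_simps)
  also have "\<dots> = complex_of_real (d * q * (q - (cmod c)\<^sup>2))"
    unfolding complex_norm_square[symmetric] by (simp add: algebra_simps)
  finally show "(nrm N (\<lambda>p. cnj c * k p - complex_of_real q * u p))\<^sup>2 = d * q * (q - (cmod c)\<^sup>2)"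
    using of_real_eq_iff by blast
qed

text \<open>Upper bound: each Kraus operator is compared with its projection onto \<open>U\<close>,
  and Cauchy-Schwarz over the list, where the \<open>q j\<close> sum to \<open>1\<close> and the
  squared moduli of the \<open>c j\<close> sum to the fidelity, produces the square root. The bound
  by \<open>1\<close> sums the inequality between these terms. Lower bound: on the maximally
  entangled state the output of \<open>\<Phi>\<close> is traceless, and its quadratic form at the
  vectorized \<open>U\<close> measures the infidelity.\<close>

lemma
  fixes \<Phi> :: "complex mat \<Rightarrow> complex mat"
  assumes U: "unitary_mat n U" and Ks: "kraus_channel n n Ks" and "0 < n"
    and \<Phi>: "\<And>\<rho>. \<rho> \<in> carrier_mat n n \<Longrightarrow> \<Phi> \<rho> = apply_kraus n Ks \<rho> - U * \<rho> * adj U"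
  shows diamond_norm_le_fidelity: "diamond_norm \<Phi> n n \<le> 2 * real n * sqrt (1 - fidelity n U Ks)"
    and fidelity_le_1: "fidelity n U Ks \<le> 1"
    and infidelity_le_diamond_norm: "1 - fidelity n U Ks \<le> diamond_norm \<Phi> n n / 2"
proof -
  define d where "d = real n"
  define m where "m = length Ks"
  define u where "u = mvec n U"
  define k where "k j = mvec n (Ks!j)" for j
  define c where "c j = ip (n*n) u (k j) / complex_of_real d" for j
  define q where "q j = (nrm (n*n) (k j))\<^sup>2 / d" for j
  have d: "d > 0" using \<open>0 < n\<close> by (simp add: d_def)
  have Uc: "U \<in> carrier_mat n n" using U by (simp add: unitary_mat_def)
  have Kc: "\<And>K. K \<in> set Ks \<Longrightarrow> K \<in> carrier_mat n n" using Ks by (simp add: kraus_channel_def)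
  have nu: "(nrm (n*n) u)\<^sup>2 = d" unfolding u_def d_def by (rule unitary_nrm[OF U])
  have nk: "(\<Sum>j<m. (nrm (n*n) (k j))\<^sup>2) = d" unfolding k_def d_def m_def by (rule kraus_nrm[OF Ks])
  then have sq: "(\<Sum>j<m. q j) = 1" using d by (simp add: q_def flip: sum_divide_distrib)
  have fid: "fidelity n U Ks = (\<Sum>j<m. (cmod (c j))\<^sup>2)"
    using d by (simp add: fidelity_def sum_list_map_nth c_def norm_divide power_divide u_def k_def m_def d_def
        flip: sum_divide_distrib)
  have ent: "\<Phi> Y $$ (a,b) =
      (\<Sum>j<m. \<Sum>i<n. \<Sum>l<n. (Ks!j) $$ (a,i) * Y $$ (i,l) * cnj ((Ks!j) $$ (b,l)))
      - (\<Sum>i<n. \<Sum>l<n. U $$ (a,i) * Y $$ (i,l) * cnj (U $$ (b,l)))"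
    if "Y \<in> carrier_mat n n" "a < n" "b < n" for Y a b
  proof -
    have "U * Y * adj U \<in> carrier_mat n n" using Uc that adj_carrier[OF Uc] by auto
    then show ?thesis
      using that index_apply_kraus[of Ks n n Y a b, OF Kc that] index_sandwich[OF Uc that] Uc
      by (simp add: \<Phi> m_def del: index_mult_mat(1))
  qed
  note res = nrm_residual[OF nu d c_def q_def]

  \<comment> \<open>\<open>K\<cdot>K\<^sup>* - q U\<cdot>U\<^sup>* = (K - cU)\<cdot>K\<^sup>* + U\<cdot>(c\<^sup>*K - qU)\<^sup>*\<close>; summed over the Kraus operators, \<open>q\<close> adds up to \<open>1\<close>.\<close>
  define A where "A jb = (\<lambda>a i. if snd jb then (Ks ! fst jb) $$ (a,i) - c (fst jb) * U $$ (a,i) else U $$ (a,i))" for jb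
  define B where "B jb = (\<lambda>a i. if snd jb then (Ks ! fst jb) $$ (a,i)
     else cnj (c (fst jb)) * (Ks ! fst jb) $$ (a,i) - complex_of_real (q (fst jb)) * U $$ (a,i))" for jb
  have op: "op_sum n \<Phi> ({..<m} \<times> UNIV) A B"
    unfolding op_sum_def
  proof (intro ballI allI impI)
    fix Y :: "complex mat" and a b assume Y: "Y \<in> carrier_mat n n" and ab: "a < n" "b < n"
    let ?u = "\<lambda>i l::nat. U $$ (a,i) * Y $$ (i,l) * cnj (U $$ (b,l))"
    have "(\<Sum>jb\<in>{..<m}\<times>UNIV. \<Sum>i<n. \<Sum>l<n. A jb a i * Y $$ (i,l) * cnj (B jb b l))
      = (\<Sum>j<m. \<Sum>i<n. \<Sum>l<n. A (j,True) a i * Y $$ (i,l) * cnj (B (j,True) b l)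
           + A (j,False) a i * Y $$ (i,l) * cnj (B (j,False) b l))"
      by (subst sum.cartesian_product') (simp add: UNIV_bool sum.distrib add.commute)
    also have "\<dots> = (\<Sum>j<m. \<Sum>i<n. \<Sum>l<n. (Ks!j) $$ (a,i) * Y $$ (i,l) * cnj ((Ks!j) $$ (b,l))
           - complex_of_real (q j) * ?u i l)"
      by (intro sum.cong refl) (simp add: A_def B_def algebra_simps)
    also have "\<dots> = (\<Sum>j<m. \<Sum>i<n. \<Sum>l<n. (Ks!j) $$ (a,i) * Y $$ (i,l) * cnj ((Ks!j) $$ (b,l)))
           - (\<Sum>j<m. complex_of_real (q j)) * (\<Sum>i<n. \<Sum>l<n. ?u i l)"
      by (simp only: sum_subtractf sum_distrib_left[symmetric] sum_distrib_right[symmetric])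
    also have "(\<Sum>j<m. complex_of_real (q j)) = 1" using sq by (metis of_real_1 of_real_sum)
    finally show "\<Phi> Y $$ (a,b) = (\<Sum>jb\<in>{..<m}\<times>UNIV. \<Sum>i<n. \<Sum>l<n. A jb a i * Y $$ (i,l) * cnj (B jb b l))"
      using ent[OF Y ab] by simp
  qed
  \<comment> \<open>By \<open>nrm_residual\<close>, \<open>d\<close> times this difference is a
    squared norm.\<close>
  have qc: "0 \<le> q j - (cmod (c j))\<^sup>2" for j
    using res(1)[of j] d by (metis zero_le_power2 zero_le_mult_iff not_less)
  have q0: "0 \<le> q j" for j using d by (simp add: q_def)
  show "fidelity n U Ks \<le> 1"
    unfolding fid sq[symmetric] by (intro sum_mono) (use qc in \<open>simp add: algebra_simps\<close>)
  have nkq: "nrm (n*n) (k j) = sqrt (d * q j)" for j using d by (simp add: q_def)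
  have nu': "nrm (n*n) u = sqrt d" using nu by (metis nrm_nonneg real_sqrt_unique)
  have n1: "nrm (n*n) (vecf n (A (j,True))) = sqrt (d * (q j - (cmod (c j))\<^sup>2))" for j
  proof -
    have "vecf n (A (j,True)) = (\<lambda>p. k j p - c j * u p)" by (auto simp: A_def vecf_def k_def u_def)
    then show ?thesis using res(1)[of j] by (metis nrm_nonneg real_sqrt_unique)
  qed
  have n2: "nrm (n*n) (vecf n (B (j,False))) = sqrt (d * q j * (q j - (cmod (c j))\<^sup>2))" for j
  proof -
    have "vecf n (B (j,False)) = (\<lambda>p. cnj (c j) * k j p - complex_of_real (q j) * u p)"
      by (auto simp: B_def vecf_def k_def u_def)
    then show ?thesis using res(2)[of j] by (metis nrm_nonneg real_sqrt_unique)
  qed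
  have n3: "vecf n (B (j,True)) = k j" "vecf n (A (j,False)) = u" for j
    by (auto simp: A_def B_def vecf_def k_def u_def)
  have "diamond_norm \<Phi> n n \<le> (\<Sum>jb\<in>{..<m}\<times>UNIV. nrm (n*n) (vecf n (A jb)) * nrm (n*n) (vecf n (B jb)))"
    by (rule diamond_norm_le[OF op])
  \<comment> \<open>The two terms belonging to \<open>j\<close> have equal norm products,
    \<open>d * sqrt (q j) * sqrt (q j - (cmod (c j))^2)\<close> each; hence the factor
    \<open>2\<close>.\<close>
  also have "\<dots> = (\<Sum>j<m. 2 * d * (sqrt (q j) * sqrt (q j - (cmod (c j))\<^sup>2)))"
  proof (subst sum.cartesian_product', rule sum.cong[OF refl])
    fix j
    have "sqrt d * sqrt d = d" using d by simp
    then show "(\<Sum>b\<in>UNIV. nrm (n*n) (vecf n (A (j,b))) * nrm (n*n) (vecf n (B (j,b))))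
      = 2 * d * (sqrt (q j) * sqrt (q j - (cmod (c j))\<^sup>2))"
      by (simp add: UNIV_bool n1 n2 n3 nkq nu' real_sqrt_mult mult_ac)
  qed
  also have "\<dots> = 2 * d * (\<Sum>j<m. \<bar>sqrt (q j)\<bar> * \<bar>sqrt (q j - (cmod (c j))\<^sup>2)\<bar>)"
    using q0 qc by (simp add: sum_distrib_left)
  also have "\<dots> \<le> 2 * d * (L2_set (\<lambda>j. sqrt (q j)) {..<m} * L2_set (\<lambda>j. sqrt (q j - (cmod (c j))\<^sup>2)) {..<m})"
    by (intro mult_left_mono L2_set_mult_ineq) (use d in simp)
  also have "\<dots> = 2 * d * sqrt (1 - fidelity n U Ks)"
    unfolding L2_set_def using q0 qc by (simp add: sq fid sum_subtractf)
  finally show "diamond_norm \<Phi> n n \<le> 2 * real n * sqrt (1 - fidelity n U Ks)" by (simp add: d_def)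

  \<comment> \<open>The maximally entangled state.\<close>
  define x where "x p = (if p div n = p mod n then complex_of_real (1 / sqrt d) else 0)" for p
  define X where "X = mat (n*n) (n*n) (\<lambda>(p,q). x p * cnj (x q))"
  have X: "X \<in> carrier_mat (n*n) (n*n)" by (simp add: X_def)
  have Xd: "X $$ (p,q) = (\<Sum>_\<in>{()}. x p * cnj (x q))" if "p < n*n" "q < n*n" for p q
    using that by (simp add: X_def)
  have "(nrm (n*n) x)\<^sup>2 = (\<Sum>a<n. \<Sum>b<n. if a = b then 1 / d else 0)"
    unfolding nrm_sq sum_div_mod[symmetric] x_def
    using d by (intro sum.cong) (auto simp: norm_divide power_divide)
  also have "\<dots> = 1" using d by (simp add: d_def)
  finally have nx: "nrm (n*n) x = 1" using nrm_nonneg[of "n*n" x] by (simp add: power2_eq_1_iff)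
  have "trace_norm X \<le> (\<Sum>_\<in>{()}. nrm (n*n) x * nrm (n*n) x)"
    by (rule trace_norm_le[OF X Xd])
  then have tX: "trace_norm X \<le> 1" by (simp add: nx)
  define D where "D = ext_id \<Phi> n n n X"
  have D: "D \<in> carrier_mat (n*n) (n*n)" unfolding D_def by (rule ext_id_carrier)
  have tD: "trace_norm D \<le> diamond_norm \<Phi> n n"
    unfolding D_def by (rule trace_norm_le_diamond[OF op X tX])
  \<comment> \<open>A second representation of \<open>\<Phi>\<close>, with the Kraus operators
    themselves and the extra index \<open>m\<close> for the subtracted \<open>U\<close> term, makes
    the entries of \<open>D\<close> explicit; the earlier one is adapted to norms.\<close>
  define A' where "A' j = (\<lambda>a i. if j < m then (Ks ! j) $$ (a,i) else - U $$ (a,i))" for j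
  define B' where "B' j = (\<lambda>a i. if j < m then (Ks ! j) $$ (a,i) else U $$ (a,i))" for j
  have op': "op_sum n \<Phi> {..<Suc m} A' B'"
    unfolding op_sum_def using ent by (auto simp: A'_def B'_def sum_negf)
  \<comment> \<open>Acting on one half of the maximally entangled state returns the operator's own
    vectorization, scaled by \<open>1 / sqrt d\<close>.\<close>
  have opx: "op_ext n M x p = complex_of_real (1 / sqrt d) * vecf n M p" if "p < n * n" for M p
  proof -
    have "op_ext n M x p = (\<Sum>i<n. if i = p mod n then M (p div n) i * complex_of_real (1 / sqrt d) else 0)"
      unfolding op_ext_def using div_mod_less[OF that] by (intro sum.cong) (auto simp: x_def)
    then show ?thesis using div_mod_less[OF that] by (simp add: vecf_def)
  qed
  have sd: "complex_of_real (1 / sqrt d) * complex_of_real (1 / sqrt d) = complex_of_real (1 / d)"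
    unfolding of_real_mult[symmetric] using d by simp
  have Dent: "D $$ (p,q) = complex_of_real (1 / d) * ((\<Sum>j<m. k j p * cnj (k j q)) - u p * cnj (u q))"
    if "p < n*n" "q < n*n" for p q
  proof -
    have "D $$ (p,q) = (\<Sum>j<Suc m. op_ext n (A' j) x p * cnj (op_ext n (B' j) x q))"
      using index_ext_id[OF op', where X = X and K = "{()}" and x = "\<lambda>_. x" and y = "\<lambda>_. x", OF Xd that]
      by (simp add: D_def flip: sum.cartesian_product)
    also have "\<dots> = (\<Sum>j<Suc m. (complex_of_real (1 / sqrt d) * complex_of_real (1 / sqrt d)) * (vecf n (A' j) p * cnj (vecf n (B' j) q)))"
      by (intro sum.cong refl) (simp only: opx that complex_cnj_mult complex_cnj_complex_of_real mult_ac)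
    also have "\<dots> = complex_of_real (1 / d) * (\<Sum>j<Suc m. vecf n (A' j) p * cnj (vecf n (B' j) q))"
      unfolding sd sum_distrib_left ..
    also have "(\<Sum>j<Suc m. vecf n (A' j) p * cnj (vecf n (B' j) q)) = (\<Sum>j<m. k j p * cnj (k j q)) - u p * cnj (u q)"
      by (simp add: A'_def B'_def vecf_def k_def u_def)
    finally show ?thesis .
  qed
  \<comment> \<open>Since this decomposition attains the trace norm, Cauchy-Schwarz bounds any sum
    of inner products of \<open>w i\<close> with a norm-preserving image of \<open>v i\<close> by
    \<open>trace_norm D\<close>.\<close>
  obtain v w where Dvw: "\<forall>p<n*n. \<forall>q<n*n. D $$ (p,q) = (\<Sum>i<n*n. v i p * cnj (w i q))"
    and tn: "(\<Sum>i<n*n. nrm (n*n) (v i) * nrm (n*n) (w i)) = trace_norm D"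
    using trace_norm_attained[OF D] by blast
  \<comment> \<open>The sum is the trace of \<open>D\<close>. It vanishes because the Kraus family
    and \<open>U\<close> have the same total squared Frobenius norm \<open>d\<close>.\<close>
  have tr0: "(\<Sum>i<n*n. ip (n*n) (w i) (v i)) = 0"
  proof -
    have "(\<Sum>i<n*n. ip (n*n) (w i) (v i)) = (\<Sum>p<n*n. \<Sum>i<n*n. cnj (w i p) * v i p)"
      unfolding ip_def by (rule sum.swap)
    also have "\<dots> = (\<Sum>p<n*n. D $$ (p,p))" using Dvw by (simp add: mult.commute)
    also have "\<dots> = complex_of_real (1 / d) * ((\<Sum>p<n*n. \<Sum>j<m. k j p * cnj (k j p)) - (\<Sum>p<n*n. u p * cnj (u p)))"
      by (simp add: Dent sum_distrib_left sum_subtractf flip: sum_divide_distrib)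
    also have "(\<Sum>p<n*n. \<Sum>j<m. k j p * cnj (k j p)) = (\<Sum>j<m. ip (n*n) (k j) (k j))"
      unfolding ip_def by (subst sum.swap) (simp add: mult.commute)
    also have "\<dots> = complex_of_real (\<Sum>j<m. (nrm (n*n) (k j))\<^sup>2)" unfolding ip_self by simp
    also have "\<dots> = complex_of_real d" using nk by simp
    also have "(\<Sum>p<n*n. u p * cnj (u p)) = ip (n*n) u u" by (simp add: ip_def mult.commute)
    also have "\<dots> = complex_of_real d" using nu by (simp add: ip_self)
    finally show ?thesis by simp
  qed
  have quad: "(\<Sum>p<N. \<Sum>r<N. cnj (u p) * (y p * cnj (z r)) * u r) = ip N u y * ip N z u" for y z N
    unfolding ip_def sum_product by (simp add: mult_ac)
  \<comment> \<open>The quadratic form of \<open>D\<close> at \<open>u\<close>: the Kraus operators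
    contribute \<open>d^2 * (cmod (c j))^2\<close> and the subtracted term \<open>d^2\<close>, both
    divided by \<open>d\<close>.\<close>
  have uD: "(\<Sum>i<n*n. ip (n*n) u (v i) * ip (n*n) (w i) u) = complex_of_real (d * (fidelity n U Ks - 1))"
  proof -
    have "(\<Sum>i<n*n. ip (n*n) u (v i) * ip (n*n) (w i) u)
       = (\<Sum>i<n*n. \<Sum>p<n*n. \<Sum>r<n*n. cnj (u p) * (v i p * cnj (w i r)) * u r)"
      unfolding quad ..
    also have "\<dots> = (\<Sum>p<n*n. \<Sum>i<n*n. \<Sum>r<n*n. cnj (u p) * (v i p * cnj (w i r)) * u r)" by (rule sum.swap)
    also have "\<dots> = (\<Sum>p<n*n. \<Sum>r<n*n. \<Sum>i<n*n. cnj (u p) * (v i p * cnj (w i r)) * u r)"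
      by (intro sum.cong refl sum.swap)
    also have "\<dots> = (\<Sum>p<n*n. \<Sum>r<n*n. cnj (u p) * D $$ (p,r) * u r)"
      using Dvw by (simp add: sum_distrib_left sum_distrib_right)
    also have "\<dots> = (\<Sum>p<n*n. \<Sum>r<n*n. complex_of_real (1 / d) * ((\<Sum>j<m. cnj (u p) * (k j p * cnj (k j r)) * u r)
        - cnj (u p) * (u p * cnj (u r)) * u r))"
      by (intro sum.cong refl) (simp add: Dent algebra_simps sum_distrib_left sum_distrib_right)
    also have "\<dots> = complex_of_real (1 / d) * ((\<Sum>p<n*n. \<Sum>r<n*n. \<Sum>j<m. cnj (u p) * (k j p * cnj (k j r)) * u r)
        - (\<Sum>p<n*n. \<Sum>r<n*n. cnj (u p) * (u p * cnj (u r)) * u r))"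
      by (simp only: sum_distrib_left sum_subtractf right_diff_distrib)
    also have "(\<Sum>p<n*n. \<Sum>r<n*n. \<Sum>j<m. cnj (u p) * (k j p * cnj (k j r)) * u r)
       = (\<Sum>p<n*n. \<Sum>j<m. \<Sum>r<n*n. cnj (u p) * (k j p * cnj (k j r)) * u r)"
      by (intro sum.cong refl sum.swap)
    also have "\<dots> = (\<Sum>j<m. \<Sum>p<n*n. \<Sum>r<n*n. cnj (u p) * (k j p * cnj (k j r)) * u r)"
      by (rule sum.swap)
    also have "\<dots> = (\<Sum>j<m. ip (n*n) u (k j) * ip (n*n) (k j) u)" unfolding quad ..
    also have "\<dots> = complex_of_real (\<Sum>j<m. d\<^sup>2 * (cmod (c j))\<^sup>2)"
    proof -
      have "ip (n*n) u (k j) * ip (n*n) (k j) u = complex_of_real (d\<^sup>2 * (cmod (c j))\<^sup>2)" for j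
      proof -
        have "ip (n*n) u (k j) * cnj (ip (n*n) u (k j)) = complex_of_real ((cmod (ip (n*n) u (k j)))\<^sup>2)"
          by (simp only: complex_norm_square)
        also have "cmod (ip (n*n) u (k j)) = d * cmod (c j)" using d by (simp add: c_def norm_divide)
        finally show ?thesis by (simp only: cnj_ip power_mult_distrib)
      qed
      then show ?thesis by simp
    qed
    also have "(\<Sum>p<n*n. \<Sum>r<n*n. cnj (u p) * (u p * cnj (u r)) * u r) = complex_of_real (d * d)"
      unfolding quad ip_self nu by simp
    also have "complex_of_real (1 / d) * (complex_of_real (\<Sum>j<m. d\<^sup>2 * (cmod (c j))\<^sup>2) - complex_of_real (d * d))
       = complex_of_real (1 / d * ((\<Sum>j<m. d\<^sup>2 * (cmod (c j))\<^sup>2) - d * d))" by simp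
    also have "1 / d * ((\<Sum>j<m. d\<^sup>2 * (cmod (c j))\<^sup>2) - d * d) = d * (fidelity n U Ks - 1)"
      using d by (simp add: fid power2_eq_square field_simps flip: sum_distrib_left)
    finally show ?thesis .
  qed
  \<comment> \<open>Since \<^term>\<open>D\<close> is traceless, pairing it with the reflection \<^term>\<open>R\<close> instead of the projection
    onto \<^term>\<open>u\<close> gains a factor of two.\<close>
  define R where "R y p = y p - complex_of_real (2 / d) * ip (n*n) u y * u p" for y p
  have nR: "nrm (n*n) (R y) = nrm (n*n) y" for y
  proof -
    have uu: "ip (n*n) u u = complex_of_real d" using nu by (simp add: ip_self)
    have "ip (n*n) (R y) (R y) = ip (n*n) y y"
      unfolding R_def[abs_def] ip_diff_left ip_diff_right ip_scale_left ip_scale_right uu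
      using d by (simp add: cnj_ip field_simps)
    then have "(nrm (n*n) (R y))\<^sup>2 = (nrm (n*n) y)\<^sup>2"
      unfolding ip_self using of_real_eq_iff by blast
    then show ?thesis by (simp add: power2_eq_iff_nonneg)
  qed
  \<comment> \<open>The right-hand side is the trace of \<open>R\<close> applied to
    \<open>D\<close>: the identity part contributes \<open>tr0\<close>, the rank-one part
    \<open>-2 / d\<close> times \<open>uD\<close>.\<close>
  have "complex_of_real (2 * (1 - fidelity n U Ks)) = (\<Sum>i<n*n. ip (n*n) (w i) (R (v i)))"
  proof -
    have "(\<Sum>i<n*n. ip (n*n) (w i) (R (v i))) = (\<Sum>i<n*n. ip (n*n) (w i) (v i))
       - complex_of_real (2 / d) * (\<Sum>i<n*n. ip (n*n) u (v i) * ip (n*n) (w i) u)"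
      unfolding R_def[abs_def] ip_diff_right ip_scale_right by (simp only: sum_subtractf sum_distrib_left mult.assoc)
    also have "\<dots> = complex_of_real (- (2 / d * (d * (fidelity n U Ks - 1))))"
      unfolding tr0 uD by simp
    also have "- (2 / d * (d * (fidelity n U Ks - 1))) = 2 * (1 - fidelity n U Ks)"
      using d by (simp add: algebra_simps)
    finally show ?thesis ..
  qed
  then have "2 * (1 - fidelity n U Ks) \<le> cmod (\<Sum>i<n*n. ip (n*n) (w i) (R (v i)))"
    by (metis abs_ge_self norm_of_real)
  also have "\<dots> \<le> (\<Sum>i<n*n. nrm (n*n) (w i) * nrm (n*n) (R (v i)))"
    by (rule order_trans[OF norm_sum]) (intro sum_mono cmod_ip_le)
  also have "\<dots> = trace_norm D" unfolding tn[symmetric] by (simp add: nR mult.commute)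
  finally show "1 - fidelity n U Ks \<le> diamond_norm \<Phi> n n / 2" using tD by simp
qed

section \<open>Kronecker products and Kraus compositions\<close>

lemma kron_carrier:
  "A \<in> carrier_mat a b \<Longrightarrow> B \<in> carrier_mat c d \<Longrightarrow> kron A B \<in> carrier_mat (a*c) (b*d)"
  by (simp add: kron_def carrier_matD)

lemma index_kron:
  assumes "A \<in> carrier_mat a b" "B \<in> carrier_mat c d" "i < a*c" "j < b*d"
  shows "kron A B $$ (i,j) = A $$ (i div c, j div d) * B $$ (i mod c, j mod d)"
  using assms by (simp add: kron_def)

text \<open>The inner index \<open>l\<close> runs over the pairs
  \<open>(l div b', l mod b')\<close>, so the sum factors into two independent ones.\<close>

lemma kron_mult:
  assumes A: "A \<in> carrier_mat a b" and B: "B \<in> carrier_mat a' b'"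
    and C: "C \<in> carrier_mat b c" and D: "D \<in> carrier_mat b' c'"
  shows "kron A B * kron C D = kron (A * C) (B * D)"
proof (rule eq_matI)
  have AC: "A * C \<in> carrier_mat a c" and BD: "B * D \<in> carrier_mat a' c'" using assms by auto
  have cr: "kron (A * C) (B * D) \<in> carrier_mat (a*a') (c*c')" by (rule kron_carrier[OF AC BD])
  show "dim_row (kron A B * kron C D) = dim_row (kron (A * C) (B * D))"
    "dim_col (kron A B * kron C D) = dim_col (kron (A * C) (B * D))"
    using kron_carrier[OF A B] kron_carrier[OF C D] cr by auto
  fix i j assume "i < dim_row (kron (A * C) (B * D))" "j < dim_col (kron (A * C) (B * D))"
  then have ij: "i < a*a'" "j < c*c'" using cr by auto
  note i' = div_mod_less[OF ij(1)] and j' = div_mod_less[OF ij(2)]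
  have "(kron A B * kron C D) $$ (i,j) = (\<Sum>l<b*b'. kron A B $$ (i,l) * kron C D $$ (l,j))"
    by (rule index_mult_sum[OF kron_carrier[OF A B] kron_carrier[OF C D] ij])
  also have "\<dots> = (\<Sum>l<b*b'. (A $$ (i div a', l div b') * C $$ (l div b', j div c')) *
      (B $$ (i mod a', l mod b') * D $$ (l mod b', j mod c')))"
    by (rule sum.cong[OF refl])
      (simp add: index_kron[OF A B ij(1)] index_kron[OF C D _ ij(2)] mult_ac)
  also have "\<dots> = (\<Sum>x<b. \<Sum>y<b'. (A $$ (i div a', x) * C $$ (x, j div c')) *
      (B $$ (i mod a', y) * D $$ (y, j mod c')))"
    by (rule sum_div_mod)
  also have "\<dots> = (A * C) $$ (i div a', j div c') * (B * D) $$ (i mod a', j mod c')"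
    using i' j' by (simp add: index_mult_sum[OF A C] index_mult_sum[OF B D] sum_product del: index_mult_mat(1))
  also have "\<dots> = kron (A * C) (B * D) $$ (i,j)"
    by (rule index_kron[OF AC BD ij, symmetric])
  finally show "(kron A B * kron C D) $$ (i,j) = kron (A * C) (B * D) $$ (i,j)" .
qed

lemma adj_kron: "adj (kron A B) = kron (adj A) (adj B)"
proof (rule eq_matI)
  fix i j assume ij: "i < dim_row (kron (adj A) (adj B))" "j < dim_col (kron (adj A) (adj B))"
  then have ij: "i < dim_col A * dim_col B" "j < dim_row A * dim_row B" by (auto simp: kron_def)
  then show "adj (kron A B) $$ (i,j) = kron (adj A) (adj B) $$ (i,j)"
    using div_mod_less[OF ij(1)] div_mod_less[OF ij(2)] by (simp add: kron_def)
qed (simp_all add: kron_def)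

lemma kron_one: "kron (1\<^sub>m m) (1\<^sub>m n) = 1\<^sub>m (m*n)"
proof (rule eq_matI)
  fix i j assume "i < dim_row (1\<^sub>m (m*n))" "j < dim_col (1\<^sub>m (m*n))"
  then have ij: "i < m*n" "j < m*n" by auto
  have "i = j \<longleftrightarrow> i div n = j div n \<and> i mod n = j mod n" by (metis div_mult_mod_eq)
  then show "kron (1\<^sub>m m) (1\<^sub>m n) $$ (i,j) = (1\<^sub>m (m*n) :: complex mat) $$ (i,j)"
    using ij div_mod_less[OF ij(1)] div_mod_less[OF ij(2)] by (auto simp: kron_def)
qed (simp_all add: kron_def)

lemma kron_one_1: "A \<in> carrier_mat m n \<Longrightarrow> kron A (1\<^sub>m 1) = A"
  by (rule eq_matI) (auto simp: kron_def)

lemma kron_add_left: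
  assumes "A \<in> carrier_mat a b" "B \<in> carrier_mat a b" "C \<in> carrier_mat c d"
  shows "kron (A + B) C = kron A C + kron B C"
  by (rule eq_matI) (use assms in \<open>auto simp: kron_def div_mod_less algebra_simps\<close>)

lemma kron_add_right:
  assumes "A \<in> carrier_mat a b" "B \<in> carrier_mat a b" "C \<in> carrier_mat c d"
  shows "kron C (A + B) = kron C A + kron C B"
  by (rule eq_matI) (use assms in \<open>auto simp: kron_def div_mod_less algebra_simps\<close>)

lemma kron_msum_left:
  assumes "\<And>M. M \<in> set Ms \<Longrightarrow> M \<in> carrier_mat a a" "C \<in> carrier_mat c c"
  shows "kron (msum a Ms) C = msum (a*c) (map (\<lambda>M. kron M C) Ms)"
  using assms(1)
proof (induction Ms)
  case Nil
  show ?case by (rule eq_matI) (use assms(2) in \<open>auto simp: kron_def div_mod_less\<close>)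
next
  case (Cons M Ms)
  then have "msum a Ms \<in> carrier_mat a a" by (auto intro: msum_carrier)
  with Cons assms(2) show ?case by (simp add: kron_add_left[of _ a a _ _ c c])
qed

lemma kron_msum_right:
  assumes "\<And>M. M \<in> set Ms \<Longrightarrow> M \<in> carrier_mat a a" "C \<in> carrier_mat c c"
  shows "kron C (msum a Ms) = msum (c*a) (map (kron C) Ms)"
  using assms(1)
proof (induction Ms)
  case Nil
  show ?case by (rule eq_matI) (use assms(2) in \<open>auto simp: kron_def div_mod_less\<close>)
next
  case (Cons M Ms)
  then have "msum a Ms \<in> carrier_mat a a" by (auto intro: msum_carrier)
  with Cons assms(2) show ?case by (simp add: kron_add_right[of _ a a _ _ c c])
qed

lemma adj_mult:
  assumes "A \<in> carrier_mat a b" "B \<in> carrier_mat b c"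
  shows "adj (A * B) = adj B * adj A"
proof (rule eq_matI)
  fix i j assume "i < dim_row (adj B * adj A)" "j < dim_col (adj B * adj A)"
  then have ij: "i < c" "j < a" using assms by auto
  have "(A * B) \<in> carrier_mat a c" using assms by auto
  then have "adj (A * B) $$ (i,j) = cnj (\<Sum>l<b. A $$ (j,l) * B $$ (l,i))"
    using ij assms by (simp add: index_mult_sum[OF assms] del: index_mult_mat(1))
  also have "\<dots> = (adj B * adj A) $$ (i,j)"
    using ij assms by (simp add: index_mult_sum[OF adj_carrier[OF assms(2)] adj_carrier[OF assms(1)]]
        mult.commute del: index_mult_mat(1))
  finally show "adj (A * B) $$ (i,j) = (adj B * adj A) $$ (i,j)" .
qed (use assms in auto)

lemma adj_one: "adj (1\<^sub>m n) = 1\<^sub>m n"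
  by (rule eq_matI) auto

lemma msum_append:
  assumes "\<And>M. M \<in> set Ms \<Longrightarrow> M \<in> carrier_mat n n" "\<And>M. M \<in> set Ns \<Longrightarrow> M \<in> carrier_mat n n"
  shows "msum n (Ms @ Ns) = msum n Ms + msum n Ns"
  using assms(1)
proof (induction Ms)
  case Nil
  then show ?case using msum_carrier[OF assms(2), of Ns] by simp
next
  case (Cons M Ms)
  then have "msum n Ms \<in> carrier_mat n n" "M \<in> carrier_mat n n" by (auto intro: msum_carrier)
  moreover have "msum n Ns \<in> carrier_mat n n" by (rule msum_carrier) (rule assms(2))
  ultimately show ?case using Cons by (simp add: assoc_add_mat[of _ n n])
qed

lemma mult_msum_mult:
  assumes A: "A \<in> carrier_mat m n" and B: "B \<in> carrier_mat n m"
    and "\<And>M. M \<in> set Ms \<Longrightarrow> M \<in> carrier_mat n n"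
  shows "A * msum n Ms * B = msum m (map (\<lambda>M. A * M * B) Ms)"
  using assms(3)
proof (induction Ms)
  case Nil
  show ?case using A B by simp
next
  case (Cons M Ms)
  then have c: "msum n Ms \<in> carrier_mat n n" "M \<in> carrier_mat n n" by (auto intro: msum_carrier)
  have "A * (M + msum n Ms) * B = (A * M + A * msum n Ms) * B"
    using A c by (simp add: mult_add_distrib_mat[of A m n _ n])
  also have "\<dots> = A * M * B + A * msum n Ms * B"
    using A B c by (simp add: add_mult_distrib_mat[of "A * M" m n _ _ m])
  finally show ?case using Cons by simp
qed

section \<open>Composition and tensor products of channels\<close>

text \<open>The arguments stand in the order of application: \<open>Ks\<close> acts first, although
  its operators are the right factors.\<close>

definition kraus_compose :: "complex mat list \<Rightarrow> complex mat list \<Rightarrow> complex mat list" where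
  "kraus_compose Ks Ls = concat (map (\<lambda>K. map (\<lambda>L. L * K) Ls) Ks)"

lemma apply_kraus_append:
  assumes "\<And>K. K \<in> set Ks \<union> set Ls \<Longrightarrow> K \<in> carrier_mat m n" "X \<in> carrier_mat n n"
  shows "apply_kraus m (Ks @ Ls) X = apply_kraus m Ks X + apply_kraus m Ls X"
  unfolding apply_kraus_def map_append
  by (rule msum_append) (use assms in \<open>auto intro!: sandwich_carrier\<close>)

lemma apply_kraus_add:
  assumes "\<And>K. K \<in> set Ks \<Longrightarrow> K \<in> carrier_mat m n" "X \<in> carrier_mat n n" "Y \<in> carrier_mat n n"
  shows "apply_kraus m Ks (X + Y) = apply_kraus m Ks X + apply_kraus m Ks Y"
proof (rule eq_matI)
  have c: "apply_kraus m Ks Z \<in> carrier_mat m m" if "Z \<in> carrier_mat n n" for Z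
    by (rule apply_kraus_carrier[OF assms(1) that])
  have XY: "X + Y \<in> carrier_mat n n" using assms by simp
  show "dim_row (apply_kraus m Ks (X + Y)) = dim_row (apply_kraus m Ks X + apply_kraus m Ks Y)"
    "dim_col (apply_kraus m Ks (X + Y)) = dim_col (apply_kraus m Ks X + apply_kraus m Ks Y)"
    using c[OF XY] c[OF assms(2)] c[OF assms(3)] by auto
  fix a b assume "a < dim_row (apply_kraus m Ks X + apply_kraus m Ks Y)"
    "b < dim_col (apply_kraus m Ks X + apply_kraus m Ks Y)"
  then have ab: "a < m" "b < m" using c[OF assms(3)] by auto
  show "apply_kraus m Ks (X + Y) $$ (a,b) = (apply_kraus m Ks X + apply_kraus m Ks Y) $$ (a,b)"
    using ab c[OF assms(2)] c[OF assms(3)] assms(2,3)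
    by (simp add: index_apply_kraus[OF assms(1) XY] index_apply_kraus[OF assms(1,2)]
        index_apply_kraus[OF assms(1,3)] algebra_simps sum.distrib)
qed

lemma apply_kraus_zero:
  assumes "\<And>K. K \<in> set Ks \<Longrightarrow> K \<in> carrier_mat m n"
  shows "apply_kraus m Ks (0\<^sub>m n n) = 0\<^sub>m m m"
proof (rule eq_matI)
  have c: "apply_kraus m Ks (0\<^sub>m n n) \<in> carrier_mat m m" by (rule apply_kraus_carrier[OF assms]) auto
  then show "dim_row (apply_kraus m Ks (0\<^sub>m n n)) = dim_row (0\<^sub>m m m)"
    "dim_col (apply_kraus m Ks (0\<^sub>m n n)) = dim_col (0\<^sub>m m m)" by auto
  fix a b assume "a < dim_row (0\<^sub>m m m)" "b < dim_col (0\<^sub>m m m)"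
  then show "apply_kraus m Ks (0\<^sub>m n n) $$ (a,b) = 0\<^sub>m m m $$ (a,b)"
    by (simp add: index_apply_kraus[OF assms zero_carrier_mat])
qed

text \<open>The outer map is additive, so it can be applied to the contribution of each
  \<open>K\<close> separately, where \<open>L\<close> after \<open>K\<close> acts as the single
  operator \<open>L * K\<close>.\<close>

lemma apply_kraus_compose:
  assumes Ls: "\<And>L. L \<in> set Ls \<Longrightarrow> L \<in> carrier_mat c b"
    and Ks: "\<And>K. K \<in> set Ks \<Longrightarrow> K \<in> carrier_mat b a" and X: "X \<in> carrier_mat a a"
  shows "apply_kraus c Ls (apply_kraus b Ks X) = apply_kraus c (kraus_compose Ks Ls) X"
  using Ks
proof (induction Ks)
  case Nil
  show ?case using apply_kraus_zero[OF Ls] by (simp add: kraus_compose_def apply_kraus_def)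
next
  case (Cons K Ks)
  have K: "K \<in> carrier_mat b a" and Ks: "\<And>K. K \<in> set Ks \<Longrightarrow> K \<in> carrier_mat b a" using Cons.prems by auto
  have "apply_kraus c Ls (K * X * adj K) = apply_kraus c (map (\<lambda>L. L * K) Ls) X"
  proof -
    have "L * (K * X * adj K) * adj L = (L * K) * X * adj (L * K)" if "L \<in> set Ls" for L
    proof -
      note L = Ls[OF that]
      note cs = L K X adj_carrier[OF L] adj_carrier[OF K]
      have "(L * K) * X * adj (L * K) = L * K * X * (adj K * adj L)" by (simp only: adj_mult[OF L K])
      also have "\<dots> = L * (K * X * adj K) * adj L"
        using cs by (simp add: assoc_mult_mat[of _ c b _ a _ a] assoc_mult_mat[of _ c b _ a _ b]
          assoc_mult_mat[of _ c b _ a _ c] assoc_mult_mat[of _ c b _ b _ c] assoc_mult_mat[of _ b a _ a _ b]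
          assoc_mult_mat[of _ b a _ a _ c] assoc_mult_mat[of _ b a _ b _ c] assoc_mult_mat[of _ a a _ b _ c]
          mult_carrier_mat[of _ _ a] mult_carrier_mat[of _ _ b])
      finally show ?thesis ..
    qed
    then show ?thesis unfolding apply_kraus_def by (simp add: o_def cong: map_cong)
  qed
  moreover have "apply_kraus b (K # Ks) X = K * X * adj K + apply_kraus b Ks X"
    by (simp add: apply_kraus_def)
  moreover have "apply_kraus c (kraus_compose (K # Ks) Ls) X =
      apply_kraus c (map (\<lambda>L. L * K) Ls) X + apply_kraus c (kraus_compose Ks Ls) X"
    unfolding kraus_compose_def concat.simps list.map
    by (rule apply_kraus_append[OF _ X]) (use Ls K Ks in \<open>auto intro!: mult_carrier_mat\<close>)
  ultimately show ?case
    using apply_kraus_add[OF Ls sandwich_carrier[OF K X] apply_kraus_carrier[OF Ks X]] Cons.IH[OF Ks] by simp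
qed

lemma kraus_channel_carrier: "kraus_channel a b Ks \<Longrightarrow> K \<in> set Ks \<Longrightarrow> K \<in> carrier_mat b a"
  by (simp add: kraus_channel_def)

lemma kraus_channel_compose:
  assumes Ks: "kraus_channel a b Ks" and Ls: "kraus_channel b c Ls"
  shows "kraus_channel a c (kraus_compose Ks Ls)"
proof -
  note Kc = kraus_channel_carrier[OF Ks] and Lc = kraus_channel_carrier[OF Ls]
  \<comment> \<open>The normalization of \<open>Ks\<close> does not pass to its tails. The induction
    therefore compares two sums over a list \<open>Ks'\<close>, using only the normalization of
    \<open>Ls\<close>.\<close>
  have "msum a (map (\<lambda>M. adj M * M) (kraus_compose Ks' Ls)) = msum a (map (\<lambda>K. adj K * K) Ks')"
    if "set Ks' \<subseteq> set Ks" for Ks'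
    using that
  proof (induction Ks')
    case (Cons K Ks')
    then have K: "K \<in> carrier_mat b a" using Kc by auto
    have "msum a (map (\<lambda>M. adj M * M) (map (\<lambda>L. L * K) Ls)) = msum a (map (\<lambda>M. adj K * M * K) (map (\<lambda>L. adj L * L) Ls))"
    proof -
      have "adj (L * K) * (L * K) = adj K * (adj L * L) * K" if "L \<in> set Ls" for L
      proof -
        note L = Lc[OF that]
        note cs = L K adj_carrier[OF L] adj_carrier[OF K]
        have "adj (L * K) * (L * K) = (adj K * adj L) * (L * K)" by (simp only: adj_mult[OF L K])
        also have "\<dots> = adj K * (adj L * L) * K"
          using cs by (simp add: assoc_mult_mat[of _ a b _ c _ a] assoc_mult_mat[of _ a b _ b _ a]
            assoc_mult_mat[of _ b c _ b _ a])
        finally show ?thesis .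
      qed
      then show ?thesis by (simp add: o_def cong: map_cong)
    qed
    also have "\<dots> = adj K * msum b (map (\<lambda>L. adj L * L) Ls) * K"
      by (rule mult_msum_mult[symmetric, OF adj_carrier[OF K] K]) (use Lc in \<open>auto intro!: gram_carrier\<close>)
    also have "\<dots> = adj K * K"
      using Ls K adj_carrier[OF K] by (simp add: kraus_channel_def)
    finally have 1: "msum a (map (\<lambda>M. adj M * M) (map (\<lambda>L. L * K) Ls)) = adj K * K" .
    have "msum a (map (\<lambda>M. adj M * M) (kraus_compose (K # Ks') Ls))
       = msum a (map (\<lambda>M. adj M * M) (map (\<lambda>L. L * K) Ls)) + msum a (map (\<lambda>M. adj M * M) (kraus_compose Ks' Ls))"
      unfolding kraus_compose_def concat.simps list.map map_append
      by (rule msum_append)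
        (use Lc Kc Cons.prems in \<open>auto intro!: gram_carrier[of _ c a] mult_carrier_mat[of _ c b _ a]\<close>)
    then show ?case using Cons by (simp only: 1) simp
  qed (simp add: kraus_compose_def)
  from this[OF subset_refl] show ?thesis
    using Ks Lc unfolding kraus_channel_def
    by (auto simp: kraus_compose_def intro!: mult_carrier_mat)
qed

lemma kraus_channel_singleton:
  assumes "P \<in> carrier_mat b a" "adj P * P = 1\<^sub>m a"
  shows "kraus_channel a b [P]"
  using assms by (simp add: kraus_channel_def)

lemma apply_kraus_singleton:
  assumes "P \<in> carrier_mat b a" "X \<in> carrier_mat a a"
  shows "apply_kraus b [P] X = P * X * adj P"
  using sandwich_carrier[OF assms] by (simp add: apply_kraus_def)

lemma isometry_kron:
  assumes "P \<in> carrier_mat b a" "adj P * P = 1\<^sub>m a" "Q \<in> carrier_mat d c" "adj Q * Q = 1\<^sub>m c"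
  shows "adj (kron P Q) * kron P Q = 1\<^sub>m (a*c)"
  unfolding adj_kron kron_mult[OF adj_carrier[OF assms(1)] adj_carrier[OF assms(3)] assms(1,3)] assms(2,4)
  by (rule kron_one)

lemma swap_mat_carrier: "swap_mat m n \<in> carrier_mat (n*m) (m*n)"
  by (simp add: swap_mat_def)

text \<open>Column \<open>j\<close> has its only nonzero entry in row \<open>s j\<close>, and
  \<open>s\<close> is injective because quotient and remainder recover \<open>j\<close>; the columns
  are thus orthonormal.\<close>

lemma swap_mat_isometry: "adj (swap_mat m n) * swap_mat m n = 1\<^sub>m (m*n)"
proof (rule eq_matI)
  let ?S = "swap_mat m n"
  note S = swap_mat_carrier[of m n]
  define s where "s j = (j mod n) * m + j div n" for j
  have Sij: "?S $$ (l,j) = (if l = s j then 1 else 0)" if "l < n*m" "j < m*n" for l j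
  proof -
    have "j div n < m" "j mod n < n" using div_mod_less[OF that(2)] by auto
    then have "s j div m = j mod n" "s j mod m = j div n" by (simp_all add: s_def)
    then have "l div m = j mod n \<and> l mod m = j div n \<longleftrightarrow> l = s j" by (metis div_mult_mod_eq)
    then show ?thesis using that by (simp add: swap_mat_def)
  qed
  have slt: "s j < n*m" if "j < m*n" for j
    using div_mod_less[OF that] by (simp add: s_def index_combine_less)
  have sinj: "s i = s j \<longleftrightarrow> i = j" if "i < m*n" "j < m*n" for i j
  proof
    assume "s i = s j"
    moreover have "s i div m = i mod n" "s i mod m = i div n" "s j div m = j mod n" "s j mod m = j div n"
      using div_mod_less[OF that(1)] div_mod_less[OF that(2)] by (simp_all add: s_def)
    ultimately show "i = j" by (metis div_mult_mod_eq)
  qed simp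
  fix i j assume "i < dim_row (1\<^sub>m (m*n))" "j < dim_col (1\<^sub>m (m*n))"
  then have ij: "i < m*n" "j < m*n" by auto
  have "(adj ?S * ?S) $$ (i,j) = (\<Sum>l<n*m. adj ?S $$ (i,l) * ?S $$ (l,j))"
    by (rule index_mult_sum[OF adj_carrier[OF S] S ij])
  also have "\<dots> = (\<Sum>l<n*m. if l = s i then (if s i = s j then 1 else 0) else 0)"
    using S ij by (intro sum.cong) (auto simp: Sij)
  also have "\<dots> = (if i = j then 1 else 0)" using slt[OF ij(1)] sinj[OF ij] by simp
  finally show "(adj ?S * ?S) $$ (i,j) = 1\<^sub>m (m*n) $$ (i,j)" using ij by simp
qed (simp_all add: swap_mat_def)

lemma kron_swap_channel:
  "kraus_channel (a*(m*n)) (a*(n*m)) [kron (1\<^sub>m a) (swap_mat m n)]"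
  by (rule kraus_channel_singleton[OF kron_carrier[OF one_carrier_mat swap_mat_carrier]])
    (rule isometry_kron[OF one_carrier_mat _ swap_mat_carrier swap_mat_isometry], simp add: adj_one)

lemma kraus_channel_kron_left:
  assumes "kraus_channel a b Ks"
  shows "kraus_channel (a*c) (b*c) (map (\<lambda>K. kron K (1\<^sub>m c)) Ks)"
proof -
  note K = kraus_channel_carrier[OF assms]
  have "adj (kron K (1\<^sub>m c)) * kron K (1\<^sub>m c) = kron (adj K * K) (1\<^sub>m c)" if "K \<in> set Ks" for K
    using kron_mult[OF adj_carrier[OF K[OF that]] one_carrier_mat K[OF that] one_carrier_mat, of c]
    by (simp add: adj_kron adj_one)
  then have m: "map (\<lambda>K. adj K * K) (map (\<lambda>K. kron K (1\<^sub>m c)) Ks)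
     = map (\<lambda>M. kron M (1\<^sub>m c)) (map (\<lambda>K. adj K * K) Ks)" by simp
  have s: "msum (a*c) (map (\<lambda>M. kron M (1\<^sub>m c)) (map (\<lambda>K. adj K * K) Ks)) = kron (1\<^sub>m a) (1\<^sub>m c)"
    using assms K by (subst kron_msum_left[symmetric]) (auto simp: kraus_channel_def intro!: gram_carrier)
  show ?thesis
    using K unfolding kraus_channel_def m s kron_one by (auto intro!: kron_carrier)
qed

lemma kraus_channel_kron_right:
  assumes "kraus_channel a b Ks"
  shows "kraus_channel (c*a) (c*b) (map (kron (1\<^sub>m c)) Ks)"
proof -
  note K = kraus_channel_carrier[OF assms]
  have "adj (kron (1\<^sub>m c) K) * kron (1\<^sub>m c) K = kron (1\<^sub>m c) (adj K * K)" if "K \<in> set Ks" for K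
    using kron_mult[OF one_carrier_mat adj_carrier[OF K[OF that]] one_carrier_mat K[OF that], of c]
    by (simp add: adj_kron adj_one)
  then have m: "map (\<lambda>K. adj K * K) (map (kron (1\<^sub>m c)) Ks)
     = map (kron (1\<^sub>m c)) (map (\<lambda>K. adj K * K) Ks)" by simp
  have s: "msum (c*a) (map (kron (1\<^sub>m c)) (map (\<lambda>K. adj K * K) Ks)) = kron (1\<^sub>m c) (1\<^sub>m a)"
    using assms K by (subst kron_msum_right[symmetric]) (auto simp: kraus_channel_def intro!: gram_carrier)
  show ?thesis
    using K unfolding kraus_channel_def m s kron_one by (auto intro!: kron_carrier)
qed

text \<open>The tensor product is the composition of the two channels acting on one side each, since
  \<open>kron K L\<close> factors as \<open>kron 1 L * kron K 1\<close>.\<close>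

lemma kraus_channel_tensor:
  assumes Ks: "kraus_channel a b Ks" and Ls: "kraus_channel c d Ls"
  shows "kraus_channel (a*c) (b*d) (kraus_tensor Ks Ls)"
proof -
  have "kron (1\<^sub>m b) L * kron K (1\<^sub>m c) = kron K L" if "K \<in> set Ks" "L \<in> set Ls" for K L
    using kraus_channel_carrier[OF Ks that(1)] kraus_channel_carrier[OF Ls that(2)]
    by (simp add: kron_mult[OF one_carrier_mat _ _ one_carrier_mat, of L d c K b a])
  then have "kraus_tensor Ks Ls = kraus_compose (map (\<lambda>K. kron K (1\<^sub>m c)) Ks) (map (kron (1\<^sub>m b)) Ls)"
    unfolding kraus_tensor_def kraus_compose_def by (simp add: o_def cong: map_cong)
  then show ?thesis
    using kraus_channel_compose[OF kraus_channel_kron_left[OF Ks, of c] kraus_channel_kron_right[OF Ls, of b]] by simp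
qed

section \<open>Non-local computation with a mixed resource\<close>

text \<open>Everything that happens after the resource has been joined to the input. The list does
  not depend on the resource state, so replacing that state only changes how the input is
  prepared.\<close>

definition nlqc_rounds :: "nat \<Rightarrow> nat \<Rightarrow> nat \<Rightarrow> nat \<Rightarrow> nat \<Rightarrow> nat \<Rightarrow> nat \<Rightarrow>
    complex mat list \<Rightarrow> complex mat list \<Rightarrow> complex mat list \<Rightarrow> complex mat list \<Rightarrow> complex mat list" where
  "nlqc_rounds dA dB dLR dKa dMa dKb dMb V V' W W' =
     kraus_compose [kron (1\<^sub>m dA) (swap_mat dB dLR)]
       (kraus_compose (kraus_tensor V V')
         (kraus_compose [kron (1\<^sub>m dKa) (swap_mat dMb (dMa*dKb))] (kraus_tensor W W')))"

text \<open>The two reorderings are isometries, hence channels with a single Kraus operator; the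
  protocol is then a composition of four channels whose dimensions match up to associativity of
  products.\<close>

lemma
  assumes V: "kraus_channel (dA*dL) (dKa*dMb) V" and V': "kraus_channel (dR*dB) (dMa*dKb) V'"
    and W: "kraus_channel (dKa*dMa) dA W" and W': "kraus_channel (dKb*dMb) dB W'"
  shows nlqc_rounds_channel:
    "kraus_channel (dA*dB*(dL*dR)) (dA*dB) (nlqc_rounds dA dB (dL*dR) dKa dMa dKb dMb V V' W W')"
    and nlqc_eq_apply_kraus: "\<rho> \<in> carrier_mat (dA*dB) (dA*dB) \<Longrightarrow> \<Psi> \<in> carrier_mat (dL*dR) (dL*dR) \<Longrightarrow>
      nlqc dA dB dL dR dKa dMa dKb dMb V V' W W' \<Psi> \<rho>
        = apply_kraus (dA*dB) (nlqc_rounds dA dB (dL*dR) dKa dMa dKb dMb V V' W W') (kron \<rho> \<Psi>)"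
proof -
  let ?P1 = "kron (1\<^sub>m dA) (swap_mat dB (dL*dR))"
  let ?P2 = "kron (1\<^sub>m dKa) (swap_mat dMb (dMa*dKb))"
  let ?n1 = "dA*dB*(dL*dR)" and ?n2 = "dA*dL*(dR*dB)" and ?n3 = "dKa*dMb*(dMa*dKb)" and ?n4 = "dKa*dMa*(dKb*dMb)"
  have P1: "kraus_channel ?n1 ?n2 [?P1]"
    using kron_swap_channel[of dA dB "dL*dR"] by (simp add: mult.assoc)
  have VV: "kraus_channel ?n2 ?n3 (kraus_tensor V V')" by (rule kraus_channel_tensor[OF V V'])
  have P2: "kraus_channel ?n3 ?n4 [?P2]"
    using kron_swap_channel[of dKa dMb "dMa*dKb"] by (simp add: mult.assoc)
  have WW: "kraus_channel ?n4 (dA*dB) (kraus_tensor W W')" by (rule kraus_channel_tensor[OF W W'])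
  note C2 = kraus_channel_compose[OF P2 WW]
  note C1 = kraus_channel_compose[OF VV C2]
  note C0 = kraus_channel_compose[OF P1 C1]
  show "kraus_channel ?n1 (dA*dB) (nlqc_rounds dA dB (dL*dR) dKa dMa dKb dMb V V' W W')"
    unfolding nlqc_rounds_def by (rule C0)
  assume \<rho>: "\<rho> \<in> carrier_mat (dA*dB) (dA*dB)" and \<Psi>: "\<Psi> \<in> carrier_mat (dL*dR) (dL*dR)"
  have X0: "kron \<rho> \<Psi> \<in> carrier_mat ?n1 ?n1" by (rule kron_carrier[OF \<rho> \<Psi>])
  have P1c: "?P1 \<in> carrier_mat ?n2 ?n1" and P2c: "?P2 \<in> carrier_mat ?n4 ?n3"
    using kraus_channel_carrier[OF P1] kraus_channel_carrier[OF P2] by auto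
  note ac = apply_kraus_carrier[OF kraus_channel_carrier]
  define X1 where "X1 = apply_kraus ?n2 [?P1] (kron \<rho> \<Psi>)"
  define X2 where "X2 = apply_kraus ?n3 (kraus_tensor V V') X1"
  have X1: "X1 \<in> carrier_mat ?n2 ?n2" unfolding X1_def by (rule ac[OF P1 _ X0])
  have X2: "X2 \<in> carrier_mat ?n3 ?n3" unfolding X2_def by (rule ac[OF VV _ X1])
  have "nlqc dA dB dL dR dKa dMa dKb dMb V V' W W' \<Psi> \<rho>
     = apply_kraus (dA*dB) (kraus_tensor W W') (apply_kraus ?n4 [?P2] X2)"
    unfolding nlqc_def Let_def X2_def X1_def
    apply_kraus_singleton[OF P1c X0] apply_kraus_singleton[OF P2c X2[unfolded X2_def X1_def apply_kraus_singleton[OF P1c X0]]] ..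
  also have "\<dots> = apply_kraus (dA*dB) (kraus_compose [?P2] (kraus_tensor W W')) X2"
    by (rule apply_kraus_compose[OF kraus_channel_carrier[OF WW] kraus_channel_carrier[OF P2] X2])
  also have "\<dots> = apply_kraus (dA*dB) (kraus_compose (kraus_tensor V V') (kraus_compose [?P2] (kraus_tensor W W'))) X1"
    unfolding X2_def
    by (rule apply_kraus_compose[OF kraus_channel_carrier[OF C2] kraus_channel_carrier[OF VV] X1])
  also have "\<dots> = apply_kraus (dA*dB) (nlqc_rounds dA dB (dL*dR) dKa dMa dKb dMb V V' W W') (kron \<rho> \<Psi>)"
    unfolding X1_def nlqc_rounds_def
    by (rule apply_kraus_compose[OF kraus_channel_carrier[OF C1] kraus_channel_carrier[OF P1] X0])
  finally show "nlqc dA dB dL dR dKa dMa dKb dMb V V' W W' \<Psi> \<rho>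
        = apply_kraus (dA*dB) (nlqc_rounds dA dB (dL*dR) dKa dMa dKb dMb V V' W W') (kron \<rho> \<Psi>)" .
qed

text \<open>The isometry \<open>v \<mapsto> v \<otimes> \<psi>\<close>, padding the input of the computation with the resource.\<close>

definition attach :: "nat \<Rightarrow> nat \<Rightarrow> complex vec \<Rightarrow> complex mat" where
  "attach n N \<psi> = kron (1\<^sub>m n) (mat N 1 (\<lambda>(i,_). \<psi> $ i))"

lemma attach_carrier: "attach n N \<psi> \<in> carrier_mat (n*N) n"
  using kron_carrier[of "1\<^sub>m n" n n "mat N 1 (\<lambda>(i,_). \<psi> $ i)" N 1] by (simp add: attach_def)

lemma is_unit_vec_ip: "is_unit_vec N \<psi> \<Longrightarrow> ip N (($) \<psi>) (($) \<psi>) = 1"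
  by (auto simp: is_unit_vec_def scalar_prod_def ip_def lessThan_atLeast0)

lemma attach_isometry:
  assumes "is_unit_vec N \<psi>"
  shows "adj (attach n N \<psi>) * attach n N \<psi> = 1\<^sub>m n"
proof -
  let ?w = "mat N 1 (\<lambda>(i,_). \<psi> $ i)"
  have w: "?w \<in> carrier_mat N 1" by simp
  have "adj ?w * ?w = 1\<^sub>m 1"
    using is_unit_vec_ip[OF assms]
    by (intro eq_matI) (auto simp: scalar_prod_def ip_def lessThan_atLeast0)
  from isometry_kron[OF one_carrier_mat _ w this, of n] show ?thesis by (simp add: attach_def adj_one)
qed

lemma attach_sandwich:
  assumes "is_unit_vec N \<psi>" and \<rho>: "\<rho> \<in> carrier_mat n n"
  shows "attach n N \<psi> * \<rho> * adj (attach n N \<psi>) = kron \<rho> (proj \<psi>)"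
proof -
  let ?w = "mat N 1 (\<lambda>(i,_). \<psi> $ i)"
  have w: "?w \<in> carrier_mat N 1" by simp
  have ww: "?w * 1\<^sub>m 1 * adj ?w = proj \<psi>"
    using assms(1) by (intro eq_matI) (auto simp: proj_def is_unit_vec_def scalar_prod_def)
  have "attach n N \<psi> * kron \<rho> (1\<^sub>m 1) = kron (1\<^sub>m n * \<rho>) (?w * 1\<^sub>m 1)"
    unfolding attach_def by (rule kron_mult[OF one_carrier_mat w \<rho> one_carrier_mat])
  then have "attach n N \<psi> * \<rho> = kron \<rho> (?w * 1\<^sub>m 1)"
    by (simp only: kron_one_1[OF \<rho>] left_mult_one_mat[OF \<rho>])
  moreover have "adj (attach n N \<psi>) = kron (1\<^sub>m n) (adj ?w)"
    by (simp only: attach_def adj_kron adj_one)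
  ultimately have "attach n N \<psi> * \<rho> * adj (attach n N \<psi>) = kron \<rho> (?w * 1\<^sub>m 1) * kron (1\<^sub>m n) (adj ?w)"
    by (simp only:)
  also have "\<dots> = kron (\<rho> * 1\<^sub>m n) (?w * 1\<^sub>m 1 * adj ?w)"
    by (rule kron_mult[OF \<rho> mult_carrier_mat[OF w one_carrier_mat] one_carrier_mat adj_carrier[OF w]])
  finally show ?thesis using \<rho> by (simp only: ww right_mult_one_mat)
qed

lemma adj_smult: "adj (c \<cdot>\<^sub>m A) = cnj c \<cdot>\<^sub>m adj A"
  by (rule eq_matI) auto

lemma smult_smult_mat: "a \<cdot>\<^sub>m (b \<cdot>\<^sub>m A) = (a * b) \<cdot>\<^sub>m (A :: complex mat)"
  by (rule eq_matI) auto

lemma smult_one_mat: "1 \<cdot>\<^sub>m A = (A :: complex mat)"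
  by (rule eq_matI) auto

lemma kron_smult_right: "B \<in> carrier_mat c d \<Longrightarrow> kron A (x \<cdot>\<^sub>m B) = x \<cdot>\<^sub>m kron A B"
  by (rule eq_matI) (auto simp: kron_def div_mod_less)

section \<open>Mixed resources as Kraus families and affinity of the fidelity\<close>

definition ens_state :: "nat \<Rightarrow> (real \<times> complex vec) list \<Rightarrow> complex mat" where
  "ens_state N ens = msum N (map (\<lambda>(p,\<psi>). complex_of_real p \<cdot>\<^sub>m proj \<psi>) ens)"

definition ensemble :: "nat \<Rightarrow> (real \<times> complex vec) list \<Rightarrow> bool" where
  "ensemble N ens \<longleftrightarrow> (\<forall>(p,\<psi>)\<in>set ens. 0 \<le> p \<and> is_unit_vec N \<psi>) \<and> (\<Sum>(p,\<psi>)\<leftarrow>ens. p) = 1"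

lemma ensembleD:
  assumes "ensemble N ens"
  shows "(p,\<psi>) \<in> set ens \<Longrightarrow> 0 \<le> p" "(p,\<psi>) \<in> set ens \<Longrightarrow> is_unit_vec N \<psi>"
    "(\<Sum>(p,\<psi>)\<leftarrow>ens. p) = 1"
  using assms by (auto simp: ensemble_def)

text \<open>Kraus operators of the channel that appends the mixed resource to its input, one per
  member of the ensemble. The mixture thereby becomes a concatenation of Kraus lists.\<close>

definition ens_kraus :: "nat \<Rightarrow> nat \<Rightarrow> (real \<times> complex vec) list \<Rightarrow> complex mat list" where
  "ens_kraus n N ens = map (\<lambda>(p,\<psi>). complex_of_real (sqrt p) \<cdot>\<^sub>m attach n N \<psi>) ens"

lemma proj_carrier: "is_unit_vec N \<psi> \<Longrightarrow> proj \<psi> \<in> carrier_mat N N"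
proof -
  assume "is_unit_vec N \<psi>"
  then have "dim_vec \<psi> = N" by (auto simp: is_unit_vec_def)
  then show ?thesis by (simp add: proj_def)
qed

lemma sqrt_mult_self_complex: "0 \<le> p \<Longrightarrow> complex_of_real (sqrt p) * complex_of_real (sqrt p) = complex_of_real p"
  by (subst of_real_mult[symmetric]) simp

lemma ens_kraus_channel:
  assumes "ensemble N ens"
  shows "kraus_channel n (n*N) (ens_kraus n N ens)"
proof -
  \<comment> \<open>The total weight is kept general here because the tail of an ensemble does not
    have weight \<open>1\<close>.\<close>
  have "msum n (map (\<lambda>K. adj K * K) (ens_kraus n N ens)) = complex_of_real (\<Sum>(p,\<psi>)\<leftarrow>ens. p) \<cdot>\<^sub>m 1\<^sub>m n"
    using ensembleD(1,2)[OF assms]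
  proof (induction ens)
    case Nil
    show ?case by (simp add: ens_kraus_def) (rule eq_matI, auto)
  next
    case (Cons x ens)
    obtain p \<psi> where x: "x = (p,\<psi>)" by (cases x)
    have p: "0 \<le> p" and \<psi>: "is_unit_vec N \<psi>" using Cons.prems(1)[of p \<psi>] Cons.prems(2)[of p \<psi>] x by auto
    let ?E = "attach n N \<psi>" and ?c = "complex_of_real (sqrt p)"
    note E = attach_carrier[of n N \<psi>]
    have "adj (?c \<cdot>\<^sub>m ?E) * (?c \<cdot>\<^sub>m ?E) = (?c * ?c) \<cdot>\<^sub>m (adj ?E * ?E)"
      using E adj_carrier[OF E]
      by (simp add: adj_smult mult_smult_distrib[of _ n "n*N" _ n] mult_smult_assoc_mat[of _ n "n*N" _ n] smult_smult_mat)
    also have "\<dots> = complex_of_real p \<cdot>\<^sub>m 1\<^sub>m n"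
      unfolding sqrt_mult_self_complex[OF p] attach_isometry[OF \<psi>] ..
    finally have "adj (?c \<cdot>\<^sub>m ?E) * (?c \<cdot>\<^sub>m ?E) = complex_of_real p \<cdot>\<^sub>m 1\<^sub>m n" .
    moreover have "msum n (map (\<lambda>K. adj K * K) (ens_kraus n N ens)) = complex_of_real (\<Sum>(p,\<psi>)\<leftarrow>ens. p) \<cdot>\<^sub>m 1\<^sub>m n"
      by (rule Cons.IH) (use Cons.prems in auto)
    ultimately show ?case by (simp add: x ens_kraus_def) (rule eq_matI, auto simp: algebra_simps)
  qed
  moreover have "K \<in> carrier_mat (n*N) n" if "K \<in> set (ens_kraus n N ens)" for K
    using that attach_carrier by (auto simp: ens_kraus_def)
  ultimately show ?thesis unfolding kraus_channel_def ensembleD(3)[OF assms] by auto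
qed

lemma apply_ens_kraus:
  assumes ens: "ensemble N ens" and \<rho>: "\<rho> \<in> carrier_mat n n"
  shows "apply_kraus (n*N) (ens_kraus n N ens) \<rho> = kron \<rho> (ens_state N ens)"
proof -
  have "K * \<rho> * adj K = kron \<rho> (complex_of_real p \<cdot>\<^sub>m proj \<psi>)"
    if pp: "(p,\<psi>) \<in> set ens" and K: "K = complex_of_real (sqrt p) \<cdot>\<^sub>m attach n N \<psi>" for p \<psi> K
  proof -
    have p: "0 \<le> p" and \<psi>: "is_unit_vec N \<psi>" using ensembleD(1,2)[OF ens pp] by auto
    let ?E = "attach n N \<psi>" and ?c = "complex_of_real (sqrt p)"
    note E = attach_carrier[of n N \<psi>]
    have "K * \<rho> * adj K = (?c * ?c) \<cdot>\<^sub>m (?E * \<rho> * adj ?E)"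
      using E adj_carrier[OF E] \<rho> unfolding K
      by (simp add: adj_smult mult_smult_distrib[of _ "n*N" n _ "n*N"] mult_smult_assoc_mat[of _ "n*N" n _ "n*N"]
         mult_smult_assoc_mat[of _ "n*N" n _ n] smult_smult_mat mult_carrier_mat[of _ "n*N" n _ n])
    then show ?thesis
      unfolding sqrt_mult_self_complex[OF p] attach_sandwich[OF \<psi> \<rho>] kron_smult_right[OF proj_carrier[OF \<psi>]] .
  qed
  then have "map (\<lambda>K. K * \<rho> * adj K) (ens_kraus n N ens) = map (kron \<rho>) (map (\<lambda>(p,\<psi>). complex_of_real p \<cdot>\<^sub>m proj \<psi>) ens)"
    by (auto simp: ens_kraus_def)
  then show ?thesis
    unfolding apply_kraus_def ens_state_def
    by (subst kron_msum_right[OF _ \<rho>]) (use ensembleD[OF ens] proj_carrier in fastforce)+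
qed

lemma kraus_compose_Cons: "kraus_compose (K # Ks) Ls = map (\<lambda>L. L * K) Ls @ kraus_compose Ks Ls"
  by (simp add: kraus_compose_def)

lemma fidelity_append: "fidelity n U (Ks @ Ls) = fidelity n U Ks + fidelity n U Ls"
  by (simp add: fidelity_def add_divide_distrib)

lemma fidelity_smult:
  assumes "\<And>L. L \<in> set Ls \<Longrightarrow> L \<in> carrier_mat n N" "E \<in> carrier_mat N n"
  shows "fidelity n U (map (\<lambda>L. L * (c \<cdot>\<^sub>m E)) Ls) = (cmod c)\<^sup>2 * fidelity n U (map (\<lambda>L. L * E) Ls)"
proof -
  have "(cmod (ip (n*n) (mvec n U) (mvec n (L * (c \<cdot>\<^sub>m E)))))\<^sup>2
     = (cmod c)\<^sup>2 * (cmod (ip (n*n) (mvec n U) (mvec n (L * E))))\<^sup>2" if "L \<in> set Ls" for L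
  proof -
    note L = assms(1)[OF that]
    have LE: "L * E \<in> carrier_mat n n" using L assms(2) by auto
    have "ip (n*n) (mvec n U) (mvec n (L * (c \<cdot>\<^sub>m E))) = ip (n*n) (mvec n U) (\<lambda>p. c * mvec n (L * E) p)"
      unfolding mult_smult_distrib[OF L assms(2)]
    proof (rule ip_cong[OF refl])
      fix p assume "p < n*n"
      then have "p div n < n" "p mod n < n" using div_mod_less by auto
      then show "mvec n (c \<cdot>\<^sub>m (L * E)) p = c * mvec n (L * E) p"
        using L assms(2) by (simp add: vecf_def del: index_mult_mat(1))
    qed
    then show ?thesis by (simp add: ip_scale_right norm_mult power_mult_distrib)
  qed
  then show ?thesis by (simp add: fidelity_def o_def sum_list_const_mult[symmetric] cong: map_cong)
qed

text \<open>Each ensemble member contributes its own block of Kraus operators, over which the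
  fidelity is additive; the prefactor \<open>sqrt p\<close> of a block comes out squared.\<close>

lemma fidelity_ens_kraus:
  assumes Ls: "\<And>L. L \<in> set Ls \<Longrightarrow> L \<in> carrier_mat n (n*N)" and "ensemble N ens"
  shows "fidelity n U (kraus_compose (ens_kraus n N ens) Ls) =
    (\<Sum>(p,\<psi>)\<leftarrow>ens. p * fidelity n U (kraus_compose (ens_kraus n N [(1,\<psi>)]) Ls))"
  using ensembleD(1)[OF assms(2)]
proof (induction ens)
  case Nil
  show ?case by (simp add: ens_kraus_def kraus_compose_def fidelity_def)
next
  case (Cons x ens)
  obtain p \<psi> where x: "x = (p,\<psi>)" by (cases x)
  have p: "0 \<le> p" using Cons.prems[of p \<psi>] x by auto
  have 1: "fidelity n U (map (\<lambda>L. L * (complex_of_real (sqrt r) \<cdot>\<^sub>m attach n N \<psi>)) Ls)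
      = r * fidelity n U (map (\<lambda>L. L * attach n N \<psi>) Ls)" if "0 \<le> r" for r
    using fidelity_smult[OF Ls attach_carrier, of Ls U "complex_of_real (sqrt r)" \<psi>] that by simp
  have 2: "kraus_compose (ens_kraus n N [(1,\<psi>)]) Ls = map (\<lambda>L. L * (complex_of_real (sqrt 1) \<cdot>\<^sub>m attach n N \<psi>)) Ls"
    by (simp add: ens_kraus_def kraus_compose_def)
  have "fidelity n U (kraus_compose (ens_kraus n N (x # ens)) Ls) =
     p * fidelity n U (kraus_compose (ens_kraus n N [(1,\<psi>)]) Ls) + fidelity n U (kraus_compose (ens_kraus n N ens) Ls)"
    unfolding 2 1[OF zero_le_one] by (simp add: x ens_kraus_def kraus_compose_Cons fidelity_append 1[OF p])
  also have "fidelity n U (kraus_compose (ens_kraus n N ens) Ls)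
     = (\<Sum>(p,\<psi>)\<leftarrow>ens. p * fidelity n U (kraus_compose (ens_kraus n N [(1,\<psi>)]) Ls))"
    by (rule Cons.IH) (use Cons.prems in auto)
  finally show ?case by (simp add: x)
qed

lemma diamond_norm_nonneg:
  assumes "op_sum n \<Phi> J A B"
  shows "0 \<le> diamond_norm \<Phi> n n"
proof -
  have "trace_norm (ext_id \<Phi> n n n (0\<^sub>m (n*n) (n*n))) \<le> diamond_norm \<Phi> n n"
    using trace_norm_zero_le[of "n*n"] by (intro trace_norm_le_diamond[OF assms]) auto
  then show ?thesis using trace_norm_nonneg[OF ext_id_carrier] by (rule order_trans[rotated])
qed

text \<open>The comparisons with the fidelity assume a positive dimension; this value settles the
  degenerate case.\<close>

lemma diamond_norm_dim_0: "diamond_norm \<Phi> 0 0 = 0"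
proof -
  have "op_sum 0 \<Phi> ({}::nat set) A A" for A by (simp add: op_sum_def)
  from diamond_norm_le[OF this] diamond_norm_nonneg[OF this] show ?thesis by simp
qed

section \<open>Averaging the diamond distance over a mixture\<close>

text \<open>Convexity of the diamond norm would bound the distance of the mixture by the average
  distance, which is the wrong direction. Passing through the fidelity works because that is affine
  under mixing, as assumption \<open>f\<close> records.\<close>

lemma average_diamond_norm_le:
  assumes U: "unitary_mat n U" and L: "kraus_channel n n L"
    and K: "\<And>j. j < m \<Longrightarrow> kraus_channel n n (K j)"
    and p: "\<And>j. j < m \<Longrightarrow> 0 \<le> p j" "(\<Sum>j<m. p j) = 1"
    and f: "fidelity n U L = (\<Sum>j<m. p j * fidelity n U (K j))"
    and \<Phi>: "\<And>\<rho>. \<rho> \<in> carrier_mat n n \<Longrightarrow> \<Phi> \<rho> = apply_kraus n L \<rho> - U * \<rho> * adj U"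
    and \<Xi>: "\<And>j \<rho>. j < m \<Longrightarrow> \<rho> \<in> carrier_mat n n \<Longrightarrow> \<Xi> j \<rho> = apply_kraus n (K j) \<rho> - U * \<rho> * adj U"
  shows "(\<Sum>j<m. p j * diamond_norm (\<Xi> j) n n) \<le> real n * sqrt (2 * diamond_norm \<Phi> n n)"
proof (cases "n = 0")
  case True
  then show ?thesis by (simp add: diamond_norm_dim_0)
next
  case False
  then have n: "0 < n" by simp
  define g where "g j = 1 - fidelity n U (K j)" for j
  have g: "0 \<le> g j" if "j < m" for j
    using fidelity_le_1[OF U K[OF that] n] by (simp add: g_def)
  have sg: "(\<Sum>j<m. p j * g j) = 1 - fidelity n U L"
    by (simp add: g_def right_diff_distrib sum_subtractf p(2) f)
  have "(\<Sum>j<m. p j * diamond_norm (\<Xi> j) n n) \<le> (\<Sum>j<m. p j * (2 * real n * sqrt (g j)))"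
    unfolding g_def
    by (intro sum_mono mult_left_mono diamond_norm_le_fidelity[OF U K n \<Xi>] p) auto
  \<comment> \<open>Splitting the weight as \<open>sqrt (p j) * sqrt (p j)\<close> prepares
    Cauchy-Schwarz: the first factor has L2 norm \<open>1\<close>, the second the square root of the
    average infidelity.\<close>
  also have "\<dots> = 2 * real n * (\<Sum>j<m. \<bar>sqrt (p j)\<bar> * \<bar>sqrt (p j * g j)\<bar>)"
    unfolding sum_distrib_left
  proof (rule sum.cong[OF refl])
    fix j assume "j \<in> {..<m}"
    then have "0 \<le> p j" "0 \<le> g j" using p g by auto
    then have "sqrt (p j) * sqrt (p j * g j) = p j * sqrt (g j)"
      by (simp add: real_sqrt_mult flip: mult.assoc)
    with \<open>0 \<le> p j\<close> \<open>0 \<le> g j\<close> show "p j * (2 * real n * sqrt (g j)) = 2 * real n * (\<bar>sqrt (p j)\<bar> * \<bar>sqrt (p j * g j)\<bar>)"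
      by simp
  qed
  also have "\<dots> \<le> 2 * real n * (L2_set (\<lambda>j. sqrt (p j)) {..<m} * L2_set (\<lambda>j. sqrt (p j * g j)) {..<m})"
    by (intro mult_left_mono L2_set_mult_ineq) simp
  also have "\<dots> = 2 * real n * sqrt (1 - fidelity n U L)"
    using p g by (simp add: L2_set_def sg cong: sum.cong_simp)
  also have "\<dots> \<le> 2 * real n * sqrt (diamond_norm \<Phi> n n / 2)"
    using infidelity_le_diamond_norm[OF U L n \<Phi>] by (intro mult_left_mono real_sqrt_le_mono) auto
  \<comment> \<open>The prefactor \<open>2\<close> moves under the root as \<open>4\<close> and
    leaves the constant \<open>2\<close> there.\<close>
  also have "\<dots> = real n * sqrt (4 * (diamond_norm \<Phi> n n / 2))"
    unfolding real_sqrt_mult by simp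
  finally show ?thesis by simp
qed

section \<open>Density matrices and their ensembles\<close>

lemma density_carrier: "density n \<rho> \<Longrightarrow> \<rho> \<in> carrier_mat n n"
  by (simp add: density_def psd_def)

lemma density_proj:
  assumes "is_unit_vec N \<psi>" shows "density N (proj \<psi>)"
  unfolding density_def
proof
  have d: "dim_vec \<psi> = N" using assms by (auto simp: is_unit_vec_def)
  show "psd N (proj \<psi>)"
  proof (rule psdI[OF proj_carrier[OF assms]])
    show "herm_fun N (entries (proj \<psi>))" by (simp add: herm_fun_def proj_def d)
    fix x
    have "ip N x (mv N (entries (proj \<psi>)) x) = ip N x (\<lambda>p. ip N (($) \<psi>) x * \<psi> $ p)"
      by (rule ip_cong) (simp_all add: mv_def proj_def d ip_def sum_distrib_left sum_distrib_right mult_ac)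
    also have "\<dots> = ip N (($) \<psi>) x * cnj (ip N (($) \<psi>) x)"
      by (simp add: ip_scale_right cnj_ip)
    also have "\<dots> = complex_of_real ((cmod (ip N (($) \<psi>) x))\<^sup>2)" by (simp only: complex_norm_square)
    finally show "0 \<le> Re (ip N x (mv N (entries (proj \<psi>)) x))" by simp
  qed
  show "mtrace (proj \<psi>) = 1"
    using is_unit_vec_ip[OF assms] by (simp add: mtrace_def proj_def d ip_def mult.commute)
qed

text \<open>The spectral decomposition is an ensemble, with weights summing to the trace. Its
  existence makes the set under the infimum in \<open>ent_formation\<close> nonempty.\<close>

lemma density_ensemble:
  assumes "density N \<rho>"
  obtains ens where "ensemble N ens" "\<rho> = ens_state N ens"
proof -
  have psd: "psd N \<rho>" and tr: "mtrace \<rho> = 1" using assms by (auto simp: density_def)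
  note \<rho> = density_carrier[OF assms]
  obtain e l where
    o: "\<And>i j. i < N \<Longrightarrow> j < N \<Longrightarrow> ip N (e i) (e j) = (if i = j then 1 else 0)" and
    eig: "\<And>j p. j < N \<Longrightarrow> p < N \<Longrightarrow> mv N (entries \<rho>) (e j) p = complex_of_real (l j) * e j p" and
    l: "\<And>j. j < N \<Longrightarrow> 0 \<le> l j"
    using psd_spectral[OF psd] by metis
  define ens where "ens = map (\<lambda>k. (l k, vec N (e k))) [0..<N]"
  have ent: "\<rho> $$ (p,q) = (\<Sum>k<N. complex_of_real (l k) * (e k p * cnj (e k q)))" if "p < N" "q < N" for p q
    using orthonormal_expand[OF o that(2), of "entries \<rho>" p] eig that by (simp add: mult_ac)
  have u: "is_unit_vec N (vec N (e k))" if "k < N" for k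
    using o[OF that that] by (simp add: is_unit_vec_def scalar_prod_def ip_def lessThan_atLeast0)
  have "complex_of_real (\<Sum>k<N. l k) = (\<Sum>k<N. complex_of_real (l k) * ip N (e k) (e k))"
    by (simp add: o)
  also have "\<dots> = (\<Sum>k<N. \<Sum>p<N. complex_of_real (l k) * (e k p * cnj (e k p)))"
    by (simp add: ip_def sum_distrib_left mult_ac)
  also have "\<dots> = (\<Sum>p<N. \<Sum>k<N. complex_of_real (l k) * (e k p * cnj (e k p)))" by (rule sum.swap)
  also have "\<dots> = 1" using tr \<rho> by (simp add: mtrace_def ent)
  finally have sl: "(\<Sum>k<N. l k) = 1" using of_real_eq_1_iff by blast
  have "\<rho> = ens_state N ens"
  proof (rule eq_matI)
    have c: "\<And>M. M \<in> set (map (\<lambda>(p,\<psi>). complex_of_real p \<cdot>\<^sub>m proj \<psi>) ens) \<Longrightarrow> M \<in> carrier_mat N N"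
      by (auto simp: ens_def proj_def)
    have ec: "ens_state N ens \<in> carrier_mat N N" unfolding ens_state_def by (rule msum_carrier[OF c])
    show "dim_row \<rho> = dim_row (ens_state N ens)" "dim_col \<rho> = dim_col (ens_state N ens)" using ec \<rho> by auto
    fix i j assume "i < dim_row (ens_state N ens)" "j < dim_col (ens_state N ens)"
    then have ij: "i < N" "j < N" using ec by auto
    show "\<rho> $$ (i,j) = ens_state N ens $$ (i,j)"
      unfolding ens_state_def
      by (subst index_msum[OF c ij]) (use ij in \<open>simp_all add: ent ens_def o_def proj_def sum_list_map_nth\<close>)
  qed
  then show thesis
    by (intro that[of ens]) (use l u sl in \<open>auto simp: ensemble_def ens_def o_def sum_list_map_nth\<close>)
qed

section \<open>Lower bound on the entanglement of formation of the resource\<close>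

theorem mainTheorem8:
  fixes dA dB :: nat and U :: "complex mat" and F :: "real \<Rightarrow> real" and lam :: real
  assumes "unitary_mat (dA*dB) U"
    and "concave_on {0..} F" and "mono_on {0..} F"
    and pure_bound: "\<And>\<epsilon> dL dR dKa dMa dKb dMb V V' W W' \<psi>.
        is_unit_vec (dL*dR) \<psi> \<Longrightarrow>
        nlqc_correct dA dB U \<epsilon> dL dR dKa dMa dKb dMb V V' W W' (proj \<psi>) \<Longrightarrow>
        vn_entropy dR (ptrace1 dL dR (proj \<psi>)) \<ge> lam - F \<epsilon>"
    and "nlqc_correct dA dB U \<epsilon> dL dR dKa dMa dKb dMb V V' W W' \<Psi>"
  shows "ent_formation dL dR \<Psi> \<ge> lam - F (real (dA*dB) * sqrt (2*\<epsilon>))"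
proof -
  let ?n = "dA*dB" and ?N = "dL*dR"
  let ?\<Phi> = "\<lambda>\<Psi> \<rho>. nlqc dA dB dL dR dKa dMa dKb dMb V V' W W' \<Psi> \<rho> - U * \<rho> * adj U"
  let ?S = "\<lambda>\<psi>. vn_entropy dR (ptrace1 dL dR (proj \<psi>))"
  define Rest where "Rest = nlqc_rounds dA dB ?N dKa dMa dKb dMb V V' W W'"
  have V: "kraus_channel (dA*dL) (dKa*dMb) V" and V': "kraus_channel (dR*dB) (dMa*dKb) V'"
    and W: "kraus_channel (dKa*dMa) dA W" and W': "kraus_channel (dKb*dMb) dB W'"
    and dens: "density ?N \<Psi>" and eps: "diamond_norm (?\<Phi> \<Psi>) ?n ?n \<le> \<epsilon>"
    using assms(5) unfolding nlqc_correct_def by auto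
  have Rest: "kraus_channel (?n * ?N) ?n Rest"
    unfolding Rest_def by (rule nlqc_rounds_channel[OF V V' W W'])
  \<comment> \<open>With the preparation of the ensemble as a first channel, the protocol is given
    by one Kraus list from AB to AB, to which the fidelity estimates apply.\<close>
  have nlqc: "nlqc dA dB dL dR dKa dMa dKb dMb V V' W W' (ens_state ?N ens) \<rho> =
      apply_kraus ?n (kraus_compose (ens_kraus ?n ?N ens) Rest) \<rho>"
    and chan: "kraus_channel ?n ?n (kraus_compose (ens_kraus ?n ?N ens) Rest)"
    if ens: "ensemble ?N ens"
      and \<rho>: "\<rho> \<in> carrier_mat ?n ?n" for ens \<rho>
  proof -
    have E: "kraus_channel ?n (?n * ?N) (ens_kraus ?n ?N ens)" by (rule ens_kraus_channel[OF ens])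
    show "kraus_channel ?n ?n (kraus_compose (ens_kraus ?n ?N ens) Rest)"
      by (rule kraus_channel_compose[OF E Rest])
    have c: "ens_state ?N ens \<in> carrier_mat ?N ?N"
      unfolding ens_state_def by (rule msum_carrier) (use ensembleD[OF ens] proj_carrier in fastforce)
    have ak: "kron \<rho> (ens_state ?N ens) = apply_kraus (?n * ?N) (ens_kraus ?n ?N ens) \<rho>"
      by (rule apply_ens_kraus[symmetric]) (use ens \<rho> in auto)
    show "nlqc dA dB dL dR dKa dMa dKb dMb V V' W W' (ens_state ?N ens) \<rho> =
      apply_kraus ?n (kraus_compose (ens_kraus ?n ?N ens) Rest) \<rho>"
      unfolding nlqc_eq_apply_kraus[OF V V' W W' \<rho> c] Rest_def[symmetric] ak
      by (rule apply_kraus_compose[OF kraus_channel_carrier[OF Rest] kraus_channel_carrier[OF E] \<rho>])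
  qed
  \<comment> \<open>It suffices to treat each ensemble separately, as \<open>ent_formation\<close>
    is the infimum of these averages.\<close>
  have bound: "lam - F (real ?n * sqrt (2*\<epsilon>)) \<le> (\<Sum>(p,\<psi>)\<leftarrow>ens. p * ?S \<psi>)"
    if ens: "ensemble ?N ens"
      and \<Psi>: "\<Psi> = ens_state ?N ens" for ens
  proof -
    define m where "m = length ens"
    define p where "p j = fst (ens ! j)" for j
    define \<psi> where "\<psi> j = snd (ens ! j)" for j
    define K where "K j = kraus_compose (ens_kraus ?n ?N [(1, \<psi> j)]) Rest" for j
    define \<delta> where "\<delta> j = diamond_norm (?\<Phi> (proj (\<psi> j))) ?n ?n" for j
    have pj: "0 \<le> p j" and \<psi>j: "is_unit_vec ?N (\<psi> j)" if "j < m" for j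
      using ensembleD(1,2)[OF ens, of "p j" "\<psi> j"] that by (auto simp: p_def \<psi>_def m_def)
    have sp: "(\<Sum>j<m. p j) = 1"
      using ensembleD(3)[OF ens] by (simp add: sum_list_map_nth m_def p_def case_prod_unfold)
    have single: "ens_state ?N [(1, \<psi> j)] = proj (\<psi> j)" if "j < m" for j
      using proj_carrier[OF \<psi>j[OF that]] by (simp add: ens_state_def smult_one_mat)
    have e1: "ensemble ?N [(1, \<psi> j)]" if "j < m" for j
      using \<psi>j[OF that] by (simp add: ensemble_def)
    \<comment> \<open>\<open>chan\<close> carries the premise on \<open>\<rho>\<close> that it
      shares with \<open>nlqc\<close>; the zero matrix discharges it.\<close>
    have Kc: "kraus_channel ?n ?n (K j)" if "j < m" for j
      unfolding K_def by (rule chan[OF e1[OF that] zero_carrier_mat])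
    have \<Xi>: "?\<Phi> (proj (\<psi> j)) \<rho> = apply_kraus ?n (K j) \<rho> - U * \<rho> * adj U"
      if "j < m" "\<rho> \<in> carrier_mat ?n ?n" for j \<rho>
      using nlqc[OF e1[OF that(1)] that(2)] by (simp add: K_def single[OF that(1)])
    have fid: "fidelity ?n U (kraus_compose (ens_kraus ?n ?N ens) Rest) = (\<Sum>j<m. p j * fidelity ?n U (K j))"
      by (subst fidelity_ens_kraus[OF kraus_channel_carrier[OF Rest]])
        (use ens in \<open>auto simp: sum_list_map_nth m_def p_def \<psi>_def K_def case_prod_unfold\<close>)
    have "(\<Sum>j<m. p j * \<delta> j) \<le> real ?n * sqrt (2 * diamond_norm (?\<Phi> \<Psi>) ?n ?n)"
      unfolding \<delta>_def
      by (rule average_diamond_norm_le[OF assms(1) chan[OF ens zero_carrier_mat] Kc pj sp fid _ \<Xi>])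
        (simp_all add: nlqc[OF ens] \<Psi>)
    also have "\<dots> \<le> real ?n * sqrt (2 * \<epsilon>)"
      using eps by (intro mult_left_mono real_sqrt_le_mono) auto
    finally have avg: "(\<Sum>j<m. p j * \<delta> j) \<le> real ?n * sqrt (2 * \<epsilon>)" .
    \<comment> \<open>Concavity and monotonicity of \<open>F\<close> are given on
      \<open>{0..}\<close> only. In positive dimension, nonnegativity follows from a fidelity at
      most \<open>1\<close> and an infidelity at most \<open>\<delta> j / 2\<close>.\<close>
    have \<delta>0: "0 \<le> \<delta> j" if "j < m" for j
    proof (cases "?n = 0")
      case True
      then show ?thesis unfolding \<delta>_def by (simp only: diamond_norm_dim_0)
    next
      case False
      then have n: "0 < ?n" by simp
      have "1 - fidelity ?n U (K j) \<le> \<delta> j / 2"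
        unfolding \<delta>_def by (rule infidelity_le_diamond_norm[OF assms(1) Kc[OF that] n \<Xi>[OF that]])
      with fidelity_le_1[OF assms(1) Kc[OF that] n \<Xi>[OF that]] show ?thesis by simp
    qed
    \<comment> \<open>The hypothesis on pure resources is used with the same local operations for
      every \<open>j\<close> and with the exact distance \<open>\<delta> j\<close> as error.\<close>
    have S: "lam - F (\<delta> j) \<le> ?S (\<psi> j)" if "j < m" for j
    proof (rule pure_bound[OF \<psi>j[OF that]])
      show "nlqc_correct dA dB U (\<delta> j) dL dR dKa dMa dKb dMb V V' W W' (proj (\<psi> j))"
        unfolding nlqc_correct_def using V V' W W' density_proj[OF \<psi>j[OF that]] by (simp add: \<delta>_def)
    qed
    have m: "m \<noteq> 0" using sp by (intro notI) simp
    \<comment> \<open>Jensen's inequality moves the average inside \<open>F\<close>; monotonicity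
      then replaces the average distance by its bound \<open>avg\<close>.\<close>
    have "(\<Sum>j<m. p j * F (\<delta> j)) \<le> F (\<Sum>j<m. p j *\<^sub>R \<delta> j)"
      by (rule concave_on_sum[OF _ _ assms(2)]) (use m sp pj \<delta>0 in auto)
    also have "\<dots> \<le> F (real ?n * sqrt (2*\<epsilon>))"
    proof (rule mono_onD[OF assms(3)])
      have "0 \<le> (\<Sum>j<m. p j * \<delta> j)" using pj \<delta>0 by (intro sum_nonneg mult_nonneg_nonneg) auto
      then show "(\<Sum>j<m. p j *\<^sub>R \<delta> j) \<in> {0..}" "real ?n * sqrt (2*\<epsilon>) \<in> {0..}"
        using avg by auto
    qed (use avg in simp)
    finally have "lam - F (real ?n * sqrt (2*\<epsilon>)) \<le> (\<Sum>j<m. p j) * lam - (\<Sum>j<m. p j * F (\<delta> j))"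
      by (simp add: sp)
    also have "\<dots> = (\<Sum>j<m. p j * (lam - F (\<delta> j)))"
      by (simp add: right_diff_distrib sum_subtractf sum_distrib_right)
    also have "\<dots> \<le> (\<Sum>j<m. p j * ?S (\<psi> j))"
      using S pj by (intro sum_mono mult_left_mono) auto
    also have "\<dots> = (\<Sum>(p,\<psi>)\<leftarrow>ens. p * ?S \<psi>)"
      by (simp add: sum_list_map_nth m_def p_def \<psi>_def case_prod_unfold)
    finally show ?thesis .
  qed
  obtain ens0 where ens0: "ensemble ?N ens0" "\<Psi> = ens_state ?N ens0"
    using density_ensemble[OF dens] by blast
  have "ent_formation dL dR \<Psi> = Inf {(\<Sum>(p,\<psi>)\<leftarrow>ens. p * ?S \<psi>) | ens. ensemble ?N ens \<and> \<Psi> = ens_state ?N ens}"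
    unfolding ent_formation_def ensemble_def ens_state_def by (simp only: conj_assoc)
  also have "lam - F (real ?n * sqrt (2*\<epsilon>)) \<le> \<dots>"
    by (rule cInf_greatest) (use ens0 bound in auto)
  finally show ?thesis .
qed

end
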